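(* Let $(M,g)$ be a compact Riemannian manifold, $A$ a symmetric real $k\times k$ matrix, and $\mathcal{F}=\{\phi_1,\dots,\phi_k\}$ a family of functions $M\to\mathbb{C}$. The following are equivalent: (i) $\mathcal{F}$ is a reduced $(-A_{ii},-A_{ij})$-eigenfamily. (ii) $A$ is positive definite and for any $x_0\in M$ the map $$\pi:(M,g)\to(T^k,A^{-1}),\qquad x\mapsto\left(\frac{\phi_1(x)}{|\phi_1(x_0)|},\dots,\frac{\phi_k(x)}{|\phi_k(x_0)|}\right)$$ is a well-defined and harmonic Riemannian submersion.
   Context: For a Riemannian manifold $(M,g)$, extend $g$ complex bilinearly to the complexified tangent bundle. For smooth functions $\phi,\psi:M\to\mathbb{C}$ let $\tau(\phi)=\operatorname{div}(\nabla\phi)$ be the (complex linear) Laplace-Beltrami operator and $\kappa(\phi,\psi)=g(\nabla\phi,\nabla\psi)$ (complex bilinear, no conjugation). Given $(\lambda_i)\in\mathbb{C}^k$ and a symmetric complex $k\times k$ matrix $(B_{ij})$, a finite family $\{\phi_1,\dots,\phi_k\}$ of functions $M\to\mathbb{C}$ is a $(\lambda_i,B_{ij})$-eigenfamily if $\tau(\phi_i)=\lambda_i\phi_i$ and $\kappa(\phi_i,\phi_j)=B_{ij}\,\phi_i\phi_j$ for all $i,j$; it is reduced if the matrix $(B_{ij})$ is non-degenerate. Thus a $(-A_{ii},-A_{ij})$-eigenfamily satisfies $\tau(\phi_i)=-A_{ii}\phi_i$ and $\kappa(\phi_i,\phi_j)=-A_{ij}\phi_i\phi_j$. For $A$ a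 positive definite $k\times k$ matrix, $(T^k,A^{-1})$ denotes the torus $T^k=(S^1)^k\subset\mathbb{C}^k$ with the flat metric $\sum_{i,j}(A^{-1})_{ij}\,dt_i\,dt_j$ in the angular coordinates $(e^{it_1},\dots,e^{it_k})$. The map $\pi$ being well-defined means that the quotients make sense and that $\pi$ takes values in $T^k$. A harmonic Riemannian submersion is a Riemannian submersion which is a harmonic map.
   Formalization: M is additionally assumed connected and no φ_i identically zero; otherwise (i) does not imply (ii): e.g. φ = e^{it} and 2e^{it} on two disjoint circles, or φ = 0 with A = (1). *)

theory Defs
  imports "HOL-Analysis.Analysis"
begin

section \<open>Smooth functions between Euclidean spaces\<close>

fun Ck_on :: "nat \<Rightarrow> 'a::real_normed_vector set \<Rightarrow> ('a \<Rightarrow> 'b::real_normed_vector) \<Rightarrow> bool" where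
  "Ck_on 0 S f \<longleftrightarrow> continuous_on S f"
| "Ck_on (Suc r) S f \<longleftrightarrow>
     (\<forall>x\<in>S. f differentiable (at x)) \<and> (\<forall>v. Ck_on r S (\<lambda>x. frechet_derivative f (at x) v))"

text \<open>The predicates above and below are only meant for open \<open>S\<close>.\<close>

definition smooth_on :: "'a::real_normed_vector set \<Rightarrow> ('a \<Rightarrow> 'b::real_normed_vector) \<Rightarrow> bool" where
  "smooth_on S f \<longleftrightarrow> (\<forall>r. Ck_on r S f)"

definition partial_deriv :: "'n \<Rightarrow> (real^'n \<Rightarrow> 'b::real_normed_vector) \<Rightarrow> real^'n \<Rightarrow> 'b" where
  "partial_deriv i f t = frechet_derivative f (at t) (axis i 1)"

definition positive_definite :: "real^'n^'n \<Rightarrow> bool" where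
  "positive_definite G \<longleftrightarrow> transpose G = G \<and> (\<forall>v. v \<noteq> 0 \<longrightarrow> v \<bullet> (G *v v) > 0)"


section \<open>Riemannian manifolds\<close>

text \<open>
  A chart is a local parametrization \<open>(V, p)\<close>: an open set \<open>V\<close> of coordinate vectors and a
  homeomorphism \<open>p\<close> from \<open>V\<close> onto an open subset of the manifold. Only the values of \<open>p\<close> on \<open>V\<close>
  matter. The Riemannian metric is the family of its component matrices in the charts: for a chart
  \<open>c = (V, p)\<close> and \<open>t \<in> V\<close>, \<open>riem_metric M c t\<close> is the matrix \<open>(g_ij)\<close> at the point \<open>p t\<close>, and
  tangent vectors at \<open>p t\<close> are represented by their components with respect to the coordinate frame.
\<close>

type_synonym ('m, 'n) chart = "(real^'n) set \<times> (real^'n \<Rightarrow> 'm)"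

record ('m, 'n) riem =
  points :: "'m set"
  charts :: "('m, 'n) chart set"
  riem_metric :: "('m, 'n) chart \<Rightarrow> real^'n \<Rightarrow> real^'n^'n"

text \<open>The coordinate representation of \<open>f\<close> with respect to \<open>(V, p)\<close> in the source and \<open>(W, q)\<close> in
  the target, and the set of coordinates on which it is meaningful.\<close>

definition local_rep ::
    "('m \<Rightarrow> 'm2) \<Rightarrow> ('m, 'n) chart \<Rightarrow> ('m2, 'k) chart \<Rightarrow> real^'n \<Rightarrow> real^'k" where
  "local_rep f c d = (\<lambda>t. inv_into (fst d) (snd d) (f (snd c t)))"

definition local_dom ::
    "('m \<Rightarrow> 'm2) \<Rightarrow> ('m, 'n) chart \<Rightarrow> ('m2, 'k) chart \<Rightarrow> (real^'n) set" where
  "local_dom f c d = {t \<in> fst c. f (snd c t) \<in> snd d ` fst d}"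

text \<open>The type class constraints make the manifold (with the subspace topology) Hausdorff and second
  countable. In the last clause \<open>J\<close> is the Jacobian matrix of the change of coordinates, so that
  the clause is the transformation law of a (0,2)-tensor.\<close>

definition riemannian_manifold ::
    "('m::{t2_space,second_countable_topology}, 'n::finite) riem \<Rightarrow> bool" where
  "riemannian_manifold M \<longleftrightarrow>
     (\<forall>(V, p) \<in> charts M. open V \<and> openin (top_of_set (points M)) (p ` V) \<and>
        homeomorphism V (p ` V) p (inv_into V p)) \<and>
     points M = (\<Union>(V, p) \<in> charts M. p ` V) \<and>
     (\<forall>c \<in> charts M. \<forall>d \<in> charts M. smooth_on (local_dom id c d) (local_rep id c d)) \<and>
     (\<forall>c \<in> charts M. (\<forall>i j. smooth_on (fst c) (\<lambda>t. riem_metric M c t $ i $ j)) \<and>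
        (\<forall>t \<in> fst c. positive_definite (riem_metric M c t))) \<and>
     (\<forall>c \<in> charts M. \<forall>d \<in> charts M. \<forall>t \<in> local_dom id c d.
        let J = matrix (frechet_derivative (local_rep id c d) (at t))
        in riem_metric M c t = transpose J ** riem_metric M d (local_rep id c d t) ** J)"


section \<open>Differential operators in local coordinates\<close>

text \<open>Here \<open>G\<close> is the component matrix of the metric in a chart, as a function of the coordinates.
  \<open>christoffel G l i j\<close> is the Christoffel symbol of the Levi-Civita connection with upper index
  \<open>l\<close> and lower indices \<open>i\<close>, \<open>j\<close>.\<close>

definition christoffel :: "(real^'n \<Rightarrow> real^'n^'n) \<Rightarrow> 'n \<Rightarrow> 'n \<Rightarrow> 'n \<Rightarrow> real^'n \<Rightarrow> real" where
  "christoffel G l i j t = (1 / 2) * (\<Sum>m\<in>UNIV. matrix_inv (G t) $ l $ m *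
     (partial_deriv i (\<lambda>s. G s $ m $ j) t + partial_deriv j (\<lambda>s. G s $ m $ i) t
      - partial_deriv m (\<lambda>s. G s $ i $ j) t))"

text \<open>Gradients of complex functions are complexified vector fields, and the metric is extended
  complex bilinearly to such fields.\<close>

definition gradient :: "(real^'n \<Rightarrow> real^'n^'n) \<Rightarrow> (real^'n \<Rightarrow> complex) \<Rightarrow> real^'n \<Rightarrow> complex^'n" where
  "gradient G u t = (\<chi> i. \<Sum>j\<in>UNIV. of_real (matrix_inv (G t) $ i $ j) * partial_deriv j u t)"

definition metric_complex :: "real^'n^'n \<Rightarrow> complex^'n \<Rightarrow> complex^'n \<Rightarrow> complex" where
  "metric_complex H X Y = (\<Sum>i\<in>UNIV. \<Sum>j\<in>UNIV. of_real (H $ i $ j) * X $ i * Y $ j)"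

text \<open>The divergence is the trace of the covariant derivative.\<close>

definition divergence ::
    "(real^'n \<Rightarrow> real^'n^'n) \<Rightarrow> (real^'n \<Rightarrow> complex^'n) \<Rightarrow> real^'n \<Rightarrow> complex" where
  "divergence G X t = (\<Sum>i\<in>UNIV. partial_deriv i (\<lambda>s. X s $ i) t
     + (\<Sum>j\<in>UNIV. of_real (christoffel G i i j t) * X t $ j))"

definition tau :: "(real^'n \<Rightarrow> real^'n^'n) \<Rightarrow> (real^'n \<Rightarrow> complex) \<Rightarrow> real^'n \<Rightarrow> complex" where
  "tau G u = divergence G (gradient G u)"

definition kappa ::
    "(real^'n \<Rightarrow> real^'n^'n) \<Rightarrow> (real^'n \<Rightarrow> complex) \<Rightarrow> (real^'n \<Rightarrow> complex) \<Rightarrow> real^'n \<Rightarrow> complex" where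
  "kappa G u v t = metric_complex (G t) (gradient G u t) (gradient G v t)"


section \<open>Eigenfamilies\<close>

definition smooth_fun :: "('m, 'n::finite) riem \<Rightarrow> ('m \<Rightarrow> complex) \<Rightarrow> bool" where
  "smooth_fun M f \<longleftrightarrow> (\<forall>(V, p) \<in> charts M. smooth_on V (f \<circ> p))"

text \<open>The equations between functions on the manifold are required in all charts; since both
  operators are invariant under changes of coordinates, each of them only has to be checked in one
  chart around every point.\<close>

definition eigenfamily ::
    "('m, 'n::finite) riem \<Rightarrow> complex^'k::finite \<Rightarrow> complex^'k^'k \<Rightarrow> ('k \<Rightarrow> 'm \<Rightarrow> complex) \<Rightarrow> bool" where
  "eigenfamily M lam B \<phi> \<longleftrightarrow>
     transpose B = B \<and>
     (\<forall>i. smooth_fun M (\<phi> i)) \<and>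
     (\<forall>(V, p) \<in> charts M. \<forall>t \<in> V.
        (\<forall>i. tau (riem_metric M (V, p)) (\<phi> i \<circ> p) t = lam $ i * \<phi> i (p t)) \<and>
        (\<forall>i j. kappa (riem_metric M (V, p)) (\<phi> i \<circ> p) (\<phi> j \<circ> p) t
                 = B $ i $ j * \<phi> i (p t) * \<phi> j (p t)))"

definition reduced_eigenfamily ::
    "('m, 'n::finite) riem \<Rightarrow> complex^'k::finite \<Rightarrow> complex^'k^'k \<Rightarrow> ('k \<Rightarrow> 'm \<Rightarrow> complex) \<Rightarrow> bool" where
  "reduced_eigenfamily M lam B \<phi> \<longleftrightarrow> eigenfamily M lam B \<phi> \<and> invertible B"


section \<open>Harmonic Riemannian submersions\<close>

definition smooth_map ::
    "('m::topological_space, 'n::finite) riem \<Rightarrow> ('m2::topological_space, 'k::finite) riem \<Rightarrow> ('m \<Rightarrow> 'm2) \<Rightarrow> bool" where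
  "smooth_map M N f \<longleftrightarrow>
     f ` points M \<subseteq> points N \<and> continuous_on (points M) f \<and>
     (\<forall>c \<in> charts M. \<forall>d \<in> charts N. smooth_on (local_dom f c d) (local_rep f c d))"

text \<open>At every point the differential \<open>D\<close> is onto and preserves the inner product of horizontal
  vectors, i.e. of vectors orthogonal to the kernel of \<open>D\<close>.\<close>

definition riemannian_submersion ::
    "('m::topological_space, 'n::finite) riem \<Rightarrow> ('m2::topological_space, 'k::finite) riem \<Rightarrow> ('m \<Rightarrow> 'm2) \<Rightarrow> bool" where
  "riemannian_submersion M N f \<longleftrightarrow>
     smooth_map M N f \<and>
     (\<forall>c \<in> charts M. \<forall>d \<in> charts N. \<forall>t \<in> local_dom f c d.
        let D = frechet_derivative (local_rep f c d) (at t);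
            G = riem_metric M c t;
            H = riem_metric N d (local_rep f c d t);
            horizontal = {u. \<forall>w. D w = 0 \<longrightarrow> u \<bullet> (G *v w) = 0}
        in surj D \<and> (\<forall>u \<in> horizontal. \<forall>v \<in> horizontal. D u \<bullet> (H *v D v) = u \<bullet> (G *v v)))"

text \<open>Components of the tension field, the trace of the second fundamental form \<open>\<nabla>df\<close>, for a map
  with coordinate representation \<open>F\<close> between domains with metrics \<open>G\<close> and \<open>H\<close>.\<close>

definition second_fundamental_form ::
    "(real^'n \<Rightarrow> real^'n^'n) \<Rightarrow> (real^'k \<Rightarrow> real^'k^'k) \<Rightarrow> (real^'n \<Rightarrow> real^'k)
      \<Rightarrow> 'k \<Rightarrow> 'n \<Rightarrow> 'n \<Rightarrow> real^'n \<Rightarrow> real" where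
  "second_fundamental_form G H F a i j t =
     partial_deriv i (partial_deriv j (\<lambda>s. F s $ a)) t
     - (\<Sum>l\<in>UNIV. christoffel G l i j t * partial_deriv l (\<lambda>s. F s $ a) t)
     + (\<Sum>b\<in>UNIV. \<Sum>c\<in>UNIV. christoffel H a b c (F t) *
          partial_deriv i (\<lambda>s. F s $ b) t * partial_deriv j (\<lambda>s. F s $ c) t)"

definition tension ::
    "(real^'n \<Rightarrow> real^'n^'n) \<Rightarrow> (real^'k \<Rightarrow> real^'k^'k) \<Rightarrow> (real^'n \<Rightarrow> real^'k)
      \<Rightarrow> real^'n \<Rightarrow> real^'k" where
  "tension G H F t = (\<chi> a. \<Sum>i\<in>UNIV. \<Sum>j\<in>UNIV.
     matrix_inv (G t) $ i $ j * second_fundamental_form G H F a i j t)"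

definition harmonic_map ::
    "('m::topological_space, 'n::finite) riem \<Rightarrow> ('m2::topological_space, 'k::finite) riem \<Rightarrow> ('m \<Rightarrow> 'm2) \<Rightarrow> bool" where
  "harmonic_map M N f \<longleftrightarrow>
     smooth_map M N f \<and>
     (\<forall>c \<in> charts M. \<forall>d \<in> charts N. \<forall>t \<in> local_dom f c d.
        tension (riem_metric M c) (riem_metric N d) (local_rep f c d) t = 0)"


section \<open>The flat torus\<close>

definition angular :: "real^'k \<Rightarrow> complex^'k" where
  "angular t = (\<chi> j. cis (t $ j))"

text \<open>The charts are the restrictions of the angular parametrization to all open sets on which it is
  injective. All of them have the constant metric components \<open>H\<close>.\<close>

definition flat_torus :: "real^'k^'k \<Rightarrow> (complex^'k, 'k::finite) riem" where
  "flat_torus H = \<lparr>points = {z. \<forall>j. norm (z $ j) = 1},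
     charts = {(V, p). p = angular \<and> open V \<and> inj_on angular V},
     riem_metric = (\<lambda>_ _. H)\<rparr>"

definition torus_map :: "('k \<Rightarrow> 'm \<Rightarrow> complex) \<Rightarrow> 'm \<Rightarrow> 'm \<Rightarrow> complex^'k" where
  "torus_map \<phi> x0 x = (\<chi> i. \<phi> i x / of_real (norm (\<phi> i x0)))"

end

theory Submission
  imports Defs
begin

text \<open>
  Let \<open>\<phi>\<close> be a member of an eigenfamily with \<open>\<tau>(\<phi>) = -a \<phi>\<close> and \<open>\<kappa>(\<phi>, \<phi>) = -a \<phi>\<^sup>2\<close>. Then
  \<open>\<tau>(|\<phi>|\<^sup>2) = 2 (|\<nabla>\<phi>|\<^sup>2 - a |\<phi>|\<^sup>2) \<ge> 0\<close>, because \<open>|\<nabla>\<phi>|\<^sup>2 \<ge> |\<kappa>(\<phi>, \<phi>)| = |a| |\<phi>|\<^sup>2\<close>. The strong maximum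
  principle on the compact connected manifold therefore makes \<open>|\<phi>|\<close> constant, so that the torus map
  is well-defined.

  Locally one can then write \<open>\<phi>\<^sub>i = r\<^sub>i exp(\<i> F\<^sub>i)\<close>, where \<open>F\<close> is the torus map in angular coordinates, and
  \<open>\<tau>(\<phi>\<^sub>i) = \<phi>\<^sub>i (\<i> \<tau>(F\<^sub>i) - |\<nabla>F\<^sub>i|\<^sup>2)\<close> and \<open>\<kappa>(\<phi>\<^sub>i, \<phi>\<^sub>j) = -\<phi>\<^sub>i \<phi>\<^sub>j g(\<nabla>F\<^sub>i, \<nabla>F\<^sub>j)\<close>. Hence the eigenfamily
  equations say exactly that \<open>\<tau>(F\<^sub>i) = 0\<close>, which is harmonicity since the target is flat, and that
  \<open>D G\<^sup>-\<^sup>1 D\<^sup>T = A\<close> for the Jacobian \<open>D\<close> of \<open>F\<close>. For positive definite \<open>A\<close> the latter is equivalent to \<open>D\<close>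
  being onto and isometric on horizontal vectors with respect to \<open>A\<^sup>-\<^sup>1\<close>.
\<close>

section \<open>Functions of class \<open>C\<^sup>k\<close>\<close>

text \<open>Working with the maximum principle keeps every estimate inside one chart; compactness
  and connectedness enter only when the set of maxima of a modulus is shown to be all of
  \<open>M\<close>. One obstacle is that the operators come in different forms: \<tau> is the
  divergence of a complex gradient, the tension field is a trace of second derivatives with
  Christoffel corrections, and the maximum principle wants a real operator without zeroth-order
  term. All of them are brought to the form \<open>elliptic_op\<close>, which makes them comparable.
  The other obstacle is that phases exist only locally. In an angular chart the phase is an inverse
  branch given by \<open>inv_into\<close>, so the openness of its domain and its differentiability
  have to be extracted from the principal logarithm of a quotient close to 1. Positive definiteness
  of \<open>A\<close> comes out of the eigenfamily as follows: the Gram matrix of the differentials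
  of the phases is always positive semidefinite, and reducedness makes it invertible.\<close>

lemma frechet_derivative_eqI:
  "(f has_derivative f') (at x) \<Longrightarrow> frechet_derivative f (at x) v = f' v"
  using frechet_derivative_at by metis

lemma frechet_derivative_has:
  "f differentiable (at x) \<Longrightarrow> (f has_derivative frechet_derivative f (at x)) (at x)"
  using frechet_derivative_works by blast

lemma Ck_on_cong:
  assumes "open S" "Ck_on r S f" "\<And>x. x \<in> S \<Longrightarrow> f x = g x"
  shows "Ck_on r S g"
  using assms(2,3)
proof (induction r arbitrary: f g)
  case 0
  then show ?case using continuous_on_cong[of S S f g] by simp
next
  case (Suc r)
  have *: "(g has_derivative frechet_derivative f (at x)) (at x)" if "x \<in> S" for x
    using that Suc.prems frechet_derivative_has[of f x] \<open>open S\<close>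
    by (auto intro: has_derivative_transform_within_open)
  have "g differentiable (at x)" if "x \<in> S" for x
    using *[OF that] by (auto simp: differentiable_def)
  moreover have "Ck_on r S (\<lambda>x. frechet_derivative g (at x) v)" for v
    using Suc.IH[of "\<lambda>x. frechet_derivative f (at x) v" "\<lambda>x. frechet_derivative g (at x) v"]
      Suc.prems frechet_derivative_eqI[OF *] by simp
  ultimately show ?case by simp
qed

lemma Ck_on_imp_continuous_on: "Ck_on r S f \<Longrightarrow> continuous_on S f"
  by (cases r) (auto intro!: continuous_at_imp_continuous_on differentiable_imp_continuous_within)

lemma Ck_on_SucD: "Ck_on (Suc r) S f \<Longrightarrow> Ck_on r S f"
proof (induction r arbitrary: f)
  case 0
  then show ?case using Ck_on_imp_continuous_on[of 1 S f] by simp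
qed simp

lemma Ck_on_SucI:
  assumes "open S" "\<And>x. x \<in> S \<Longrightarrow> (f has_derivative f' x) (at x)"
    "\<And>v. Ck_on r S (\<lambda>x. f' x v)"
  shows "Ck_on (Suc r) S f"
proof -
  have "Ck_on r S (\<lambda>x. frechet_derivative f (at x) v)" for v
    by (rule Ck_on_cong[OF assms(1) assms(3)[of v]])
      (simp add: frechet_derivative_eqI[OF assms(2)])
  then show ?thesis using assms(2) by (auto simp: differentiable_def)
qed

lemma Ck_on_subset: "Ck_on r S f \<Longrightarrow> T \<subseteq> S \<Longrightarrow> Ck_on r T f"
  by (induction r arbitrary: f) (auto intro: continuous_on_subset)

lemma Ck_on_locally:
  assumes "\<And>x. x \<in> S \<Longrightarrow> \<exists>T. open T \<and> x \<in> T \<and> Ck_on r T f"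
  shows "Ck_on r S f"
  using assms
proof (induction r arbitrary: f)
  case 0
  then have "continuous (at x) f" if "x \<in> S" for x
    using that continuous_on_eq_continuous_at by fastforce
  then show ?case by (simp add: continuous_at_imp_continuous_on)
next
  case (Suc r)
  have "Ck_on r S (\<lambda>x. frechet_derivative f (at x) v)" for v
  proof (rule Suc.IH)
    fix x assume "x \<in> S"
    then show "\<exists>T. open T \<and> x \<in> T \<and> Ck_on r T (\<lambda>x. frechet_derivative f (at x) v)"
      using Suc.prems[of x] by auto
  qed
  then show ?case using Suc.prems by fastforce
qed

lemma Ck_on_bounded_linear:
  assumes "bounded_linear h" "open S" "Ck_on r S f"
  shows "Ck_on r S (\<lambda>x. h (f x))"
  using assms(3)
proof (induction r arbitrary: f)
  case 0
  then show ?case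
    using bounded_linear.continuous_on[OF assms(1)] by simp
next
  case (Suc r)
  show ?case
  proof (rule Ck_on_SucI[OF assms(2)])
    show "((\<lambda>x. h (f x)) has_derivative (\<lambda>v. h (frechet_derivative f (at x) v))) (at x)"
      if "x \<in> S" for x
      using that Suc.prems
      by (auto intro!: bounded_linear.has_derivative[OF assms(1)] frechet_derivative_has)
  qed (use Suc in auto)
qed

lemma Ck_on_add:
  assumes "open S" "Ck_on r S f" "Ck_on r S g"
  shows "Ck_on r S (\<lambda>x. f x + g x)"
  using assms(2,3)
proof (induction r arbitrary: f g)
  case 0
  then show ?case by (auto intro: continuous_intros)
next
  case (Suc r)
  show ?case
  proof (rule Ck_on_SucI[OF assms(1)])
    show "((\<lambda>x. f x + g x) has_derivative
        (\<lambda>v. frechet_derivative f (at x) v + frechet_derivative g (at x) v)) (at x)"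
      if "x \<in> S" for x
      using that Suc.prems by (auto intro!: has_derivative_add frechet_derivative_has)
  qed (use Suc in auto)
qed

lemma Ck_on_zero: "open S \<Longrightarrow> Ck_on r S (\<lambda>x. 0)"
proof (induction r)
  case (Suc r)
  then show ?case by (intro Ck_on_SucI) auto
qed simp

lemma Ck_on_const: "open S \<Longrightarrow> Ck_on r S (\<lambda>x. c)"
proof (cases r)
  case (Suc r)
  assume "open S"
  then show ?thesis unfolding Suc by (intro Ck_on_SucI[where f' = "\<lambda>x v. 0"]) (auto intro: Ck_on_zero)
qed simp

lemma Ck_on_sum:
  assumes "open S" "\<And>i. i \<in> I \<Longrightarrow> Ck_on r S (f i)"
  shows "Ck_on r S (\<lambda>x. \<Sum>i\<in>I. f i x)"
  using assms(2)
  by (induction I rule: infinite_finite_induct) (auto intro: Ck_on_add Ck_on_zero assms(1))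

lemma Ck_on_bilinear:
  assumes "bounded_bilinear h" "open S" "Ck_on r S f" "Ck_on r S g"
  shows "Ck_on r S (\<lambda>x. h (f x) (g x))"
  using assms(3,4)
proof (induction r arbitrary: f g)
  case 0
  then show ?case using bounded_bilinear.continuous_on[OF assms(1)] by simp
next
  case (Suc r)
  show ?case
  proof (rule Ck_on_SucI[OF assms(2)])
    show "((\<lambda>x. h (f x) (g x)) has_derivative
        (\<lambda>v. h (f x) (frechet_derivative g (at x) v) + h (frechet_derivative f (at x) v) (g x))) (at x)"
      if "x \<in> S" for x
      by (rule bounded_bilinear.FDERIV[OF assms(1) frechet_derivative_has frechet_derivative_has])
        (use that Suc.prems in auto)
    show "Ck_on r S (\<lambda>x. h (f x) (frechet_derivative g (at x) v)
        + h (frechet_derivative f (at x) v) (g x))" for v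
      by (intro Ck_on_add[OF assms(2)] Suc.IH) (use Suc.prems Ck_on_SucD in auto)
  qed
qed

lemma basis_expansion_scaleR: "(\<Sum>i\<in>UNIV. (x::real^'n) $ i *\<^sub>R axis i 1) = x"
  using basis_expansion[of x] by (simp only: scalar_mult_eq_scaleR)

lemma Ck_on_vec:
  fixes f :: "'a::real_normed_vector \<Rightarrow> real^'k"
  assumes "open S" "\<And>i. Ck_on r S (\<lambda>x. f x $ i)"
  shows "Ck_on r S f"
proof -
  have "Ck_on r S (\<lambda>x. \<Sum>i\<in>UNIV. f x $ i *\<^sub>R axis i 1)"
    by (intro Ck_on_sum assms(1) Ck_on_bounded_linear[OF bounded_linear_scaleR_left] assms(2))
  then show ?thesis
    by (rule Ck_on_cong[OF assms(1)]) (rule basis_expansion_scaleR)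
qed

lemma has_derivative_cis:
  assumes "(F has_derivative F') (at x)"
  shows "((\<lambda>x. cis (F x)) has_derivative (\<lambda>v. F' v *\<^sub>R (\<i> * cis (F x)))) (at x)"
proof -
  have "(exp has_derivative (*) (exp (\<i> * complex_of_real (F x)))) (at (\<i> * complex_of_real (F x)))"
    using DERIV_exp by (simp only: has_field_derivative_def)
  from has_derivative_compose[OF has_derivative_mult_right[OF has_derivative_of_real[OF assms]] this]
  have "((\<lambda>x. exp (\<i> * complex_of_real (F x))) has_derivative
     (\<lambda>v. exp (\<i> * complex_of_real (F x)) * (\<i> * complex_of_real (F' v)))) (at x)" .
  moreover have "(\<lambda>v. exp (\<i> * complex_of_real (F x)) * (\<i> * complex_of_real (F' v)))
      = (\<lambda>v. F' v *\<^sub>R (\<i> * cis (F x)))"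
    by (simp add: fun_eq_iff cis_conv_exp scaleR_conv_of_real)
  ultimately show ?thesis by (simp only: cis_conv_exp)
qed

lemma Ck_on_cis:
  assumes "open S" "Ck_on r S F"
  shows "Ck_on r S (\<lambda>x. cis (F x))"
  using assms(2)
proof (induction r arbitrary: F)
  case 0
  then show ?case by (auto intro: continuous_intros)
next
  case (Suc r)
  show ?case
  proof (rule Ck_on_SucI[OF assms(1)])
    show "((\<lambda>x. cis (F x)) has_derivative
        (\<lambda>v. frechet_derivative F (at x) v *\<^sub>R (\<i> * cis (F x)))) (at x)" if "x \<in> S" for x
      using that Suc.prems by (auto intro!: has_derivative_cis frechet_derivative_has)
    show "Ck_on r S (\<lambda>x. frechet_derivative F (at x) v *\<^sub>R (\<i> * cis (F x)))" for v
      using Suc.prems Ck_on_SucD[OF Suc.prems]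
      by (intro Ck_on_bilinear[OF bounded_bilinear_scaleR]
          Ck_on_bounded_linear[OF bounded_linear_mult_right] assms(1) Suc.IH) auto
  qed
qed

text \<open>With \<psi> = cis F, the differential of F is Im (cnj \<psi> d\<psi>). The right side
  mentions only \<psi>, so no induction on \<open>r\<close> is needed. Differentiability of F is
  assumed because cis F alone cannot exclude jumps of F by multiples of 2 pi.\<close>

lemma Ck_on_angle:
  assumes "open S" "Ck_on r S (\<lambda>x. cis (F x))" "\<And>x. x \<in> S \<Longrightarrow> F differentiable (at x)"
  shows "Ck_on r S F"
proof (cases r)
  case 0
  then show ?thesis using assms(3)
    by (auto intro!: continuous_at_imp_continuous_on differentiable_imp_continuous_within)
next
  case (Suc r')
  let ?\<psi> = "\<lambda>x. cis (F x)"
  show ?thesis unfolding Suc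
  proof (rule Ck_on_SucI[OF assms(1)])
    show *: "(F has_derivative (\<lambda>v. Im (cnj (cis (F x)) * frechet_derivative ?\<psi> (at x) v))) (at x)"
      if "x \<in> S" for x
    proof -
      have F: "(F has_derivative frechet_derivative F (at x)) (at x)"
        using assms(3) that frechet_derivative_has by blast
      have "frechet_derivative ?\<psi> (at x) v = frechet_derivative F (at x) v *\<^sub>R (\<i> * cis (F x))" for v
        by (rule frechet_derivative_eqI[OF has_derivative_cis[OF F]])
      then have "Im (cnj (cis (F x)) * frechet_derivative ?\<psi> (at x) v)
          = Im (frechet_derivative F (at x) v *\<^sub>R (\<i> * (cis (F x) * cnj (cis (F x)))))" for v
        by (simp add: algebra_simps)
      then show ?thesis using F by (simp add: cis_cnj cis_mult)
    qed
    show "Ck_on r' S (\<lambda>x. Im (cnj (cis (F x)) * frechet_derivative ?\<psi> (at x) v))" for v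
      using assms(2) Ck_on_SucD[of r' S ?\<psi>] unfolding Suc
      by (intro Ck_on_bounded_linear[OF bounded_linear_Im] Ck_on_bilinear[OF bounded_bilinear_mult]
          Ck_on_bounded_linear[OF bounded_linear_cnj] assms(1)) auto
  qed
qed

section \<open>Calculus of partial derivatives\<close>

lemma partial_deriv_eqI:
  "(f has_derivative f') (at t) \<Longrightarrow> partial_deriv i f t = f' (axis i 1)"
  unfolding partial_deriv_def by (rule frechet_derivative_eqI)

lemma has_derivative_partial:
  assumes "f differentiable (at t)"
  shows "(f has_derivative (\<lambda>v. \<Sum>i\<in>UNIV. v $ i *\<^sub>R partial_deriv i f t)) (at t)"
proof -
  have lin: "linear (frechet_derivative f (at t))"
    using assms linear_frechet_derivative by blast
  have "frechet_derivative f (at t) v = (\<Sum>i\<in>UNIV. v $ i *\<^sub>R partial_deriv i f t)" for v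
    using arg_cong[OF basis_expansion_scaleR[of v], of "frechet_derivative f (at t)"]
    by (simp only: linear_sum[OF lin] linear_cmul[OF lin] partial_deriv_def)
  then have "frechet_derivative f (at t) = (\<lambda>v. \<Sum>i\<in>UNIV. v $ i *\<^sub>R partial_deriv i f t)"
    by (rule ext)
  then show ?thesis using frechet_derivative_has[OF assms] by (simp only:)
qed

lemma has_derivative_imp_differentiable:
  "(f has_derivative f') F \<Longrightarrow> f differentiable F"
  by (auto simp: differentiable_def)

text \<open>Both functions have exactly the same derivatives at \<open>t\<close>, so the choice
  inside \<open>frechet_derivative\<close> returns the same map even at a point where there is
  none.\<close>

lemma partial_deriv_cong:
  assumes "open S" "t \<in> S" "\<And>x. x \<in> S \<Longrightarrow> f x = g x"
  shows "partial_deriv i f t = partial_deriv i g t"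
proof -
  have "(f has_derivative D) (at t) \<longleftrightarrow> (g has_derivative D) (at t)" for D
  proof
    show "(g has_derivative D) (at t)" if "(f has_derivative D) (at t)"
      by (rule has_derivative_transform_within_open[OF that assms])
    show "(f has_derivative D) (at t)" if "(g has_derivative D) (at t)"
      by (rule has_derivative_transform_within_open[OF that assms(1,2)]) (simp add: assms(3))
  qed
  then show ?thesis by (simp only: partial_deriv_def frechet_derivative_def)
qed

lemma partial_deriv_add:
  assumes "f differentiable (at t)" "g differentiable (at t)"
  shows "partial_deriv i (\<lambda>s. f s + g s) t = partial_deriv i f t + partial_deriv i g t"
  using partial_deriv_eqI[OF has_derivative_add[OF assms[THEN frechet_derivative_has]]]
  by (simp add: partial_deriv_def)

lemma partial_deriv_mult:
  fixes f g :: "real^'n \<Rightarrow> 'b::real_normed_algebra"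
  assumes "f differentiable (at t)" "g differentiable (at t)"
  shows "partial_deriv i (\<lambda>s. f s * g s) t = f t * partial_deriv i g t + partial_deriv i f t * g t"
  using partial_deriv_eqI[OF has_derivative_mult[OF assms[THEN frechet_derivative_has]]]
  by (simp add: partial_deriv_def)

lemma partial_deriv_bounded_linear:
  assumes "bounded_linear h" "f differentiable (at t)"
  shows "partial_deriv i (\<lambda>s. h (f s)) t = h (partial_deriv i f t)"
  using partial_deriv_eqI[OF bounded_linear.has_derivative[OF assms(1) frechet_derivative_has[OF assms(2)]]]
  by (simp add: partial_deriv_def)

lemma partial_deriv_sum:
  assumes "\<And>i. i \<in> I \<Longrightarrow> f i differentiable (at t)"
  shows "partial_deriv j (\<lambda>s. \<Sum>i\<in>I. f i s) t = (\<Sum>i\<in>I. partial_deriv j (f i) t)"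
  using partial_deriv_eqI[OF has_derivative_sum[OF assms[THEN frechet_derivative_has]]]
  by (simp add: partial_deriv_def)

lemma partial_deriv_compose:
  fixes \<rho> :: "real^'n \<Rightarrow> real"
  assumes "(E has_vector_derivative E') (at (\<rho> t))" "\<rho> differentiable (at t)"
  shows "partial_deriv i (\<lambda>s. E (\<rho> s)) t = partial_deriv i \<rho> t *\<^sub>R E'"
  using partial_deriv_eqI[OF has_derivative_compose[OF frechet_derivative_has[OF assms(2)]
      assms(1)[unfolded has_vector_derivative_def]]]
  by (simp add: partial_deriv_def)

lemma Ck_on_partial_deriv: "Ck_on (Suc r) S f \<Longrightarrow> Ck_on r S (partial_deriv i f)"
  by (simp add: partial_deriv_def[abs_def])

lemma Ck_on_imp_differentiable: "Ck_on (Suc r) S f \<Longrightarrow> x \<in> S \<Longrightarrow> f differentiable (at x)"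
  by simp

section \<open>Quadratic forms and maxima\<close>

lemma symmetric_inner:
  fixes a :: "real^'n^'n"
  assumes "transpose a = a"
  shows "u \<bullet> (a *v v) = v \<bullet> (a *v u)"
  by (metis assms dot_lmul_matrix inner_commute transpose_matrix_vector)

lemma quadratic_form_sum:
  fixes a :: "real^'n^'n"
  shows "u \<bullet> (a *v v) = (\<Sum>i\<in>UNIV. \<Sum>j\<in>UNIV. a $ i $ j * (u $ i * v $ j))"
  by (simp add: inner_vec_def matrix_vector_mult_def sum_distrib_left mult_ac)

text \<open>Completing the square, one index at a time: \<open>I\<close> contains the indices of the
  rows that may still be nonzero, and each step splits off one square and clears one row and
  column.\<close>

lemma psd_sum_of_squares:
  fixes a :: "real^'n^'n"
  assumes "finite I" "transpose a = a" "\<And>v. 0 \<le> v \<bullet> (a *v v)"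
    "\<And>i j. i \<notin> I \<Longrightarrow> a $ i $ j = 0"
  shows "\<exists>c. \<forall>i j. a $ i $ j = (\<Sum>k\<in>I. c k $ i * c k $ j)"
  using assms
proof (induction I arbitrary: a rule: finite_induct)
  case empty
  then show ?case by simp
next
  case (insert x I)
  define q where "q = a $ x $ x"
  define r where "r = a $ x"
  have sym: "a $ i $ j = a $ j $ i" for i j
    using insert.prems(1) by (metis transpose_def vec_lambda_beta)
  have mulx: "a *v axis x 1 = r"
    by (simp add: matrix_vector_mult_def axis_def vec_eq_iff r_def sym[of _ x] if_distrib cong: if_cong)
  have shift: "(v + s *\<^sub>R axis x 1) \<bullet> (a *v (v + s *\<^sub>R axis x 1))
      = v \<bullet> (a *v v) + 2 * s * (r \<bullet> v) + s\<^sup>2 * q" for v s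
  proof -
    have "axis x 1 \<bullet> (a *v v) = r \<bullet> v"
      using symmetric_inner[OF insert.prems(1), of "axis x 1" v] by (simp add: mulx inner_commute)
    moreover have "axis x 1 \<bullet> r = q"
      by (simp add: inner_axis' q_def r_def)
    ultimately show ?thesis
      by (simp add: matrix_vector_right_distrib matrix_vector_mult_scaleR mulx inner_add_left
          inner_add_right power2_eq_square algebra_simps inner_commute[of v r])
  qed
  have nonneg: "0 \<le> v \<bullet> (a *v v) + 2 * s * (r \<bullet> v) + s\<^sup>2 * q" for v s
    using insert.prems(2) shift by metis
  have "0 \<le> q" using nonneg[of 0 1] by simp
  have r0: "r $ j = 0" if "q = 0" for j
  proof (rule ccontr)
    assume "r $ j \<noteq> 0"
    define X where "X = axis j 1 \<bullet> (a *v axis j 1)"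
    \<comment> \<open>A form with vanishing diagonal entry \<open>q\<close> is affine in
      \<open>s\<close>; this \<open>s\<close> gives it the value -1.\<close>
    define s where "s = - (X + 1) / (2 * r $ j)"
    have "r \<bullet> axis j 1 = r $ j" by (simp add: inner_axis)
    then have "0 \<le> X + 2 * s * r $ j"
      using nonneg[of "axis j 1" s] that by (simp add: X_def)
    also have "2 * s * r $ j = - (X + 1)"
      using \<open>r $ j \<noteq> 0\<close> by (simp add: s_def)
    finally show False by simp
  qed
  \<comment> \<open>The Schur complement of the entry \<open>q\<close>. For q > 0 its quadratic form
    at \<open>v\<close> is the minimum over \<open>s\<close> of the form at
    \<open>v + s *\<^sub>R axis x 1\<close>, attained at s = -(r \<bullet> v) / q. For q = 0 the
    division yields 0, so a' = a, and \<open>r0\<close> says that the row is already zero.\<close>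
  define a' where "a' = (\<chi> i j. a $ i $ j - r $ i * r $ j / q)"
  have quad': "v \<bullet> (a' *v v) = v \<bullet> (a *v v) - (r \<bullet> v)\<^sup>2 / q" for v
  proof -
    have "(r \<bullet> v)\<^sup>2 = (\<Sum>i\<in>UNIV. \<Sum>j\<in>UNIV. (r $ i * v $ i) * (r $ j * v $ j))"
      by (simp add: power2_eq_square inner_vec_def sum_product)
    then show ?thesis
      unfolding quadratic_form_sum a'_def
      by (simp add: sum_divide_distrib algebra_simps sum_subtractf)
  qed
  have "\<exists>c. \<forall>i j. a' $ i $ j = (\<Sum>k\<in>I. c k $ i * c k $ j)"
  proof (rule insert.IH)
    show "transpose a' = a'"
      by (simp add: transpose_def a'_def vec_eq_iff sym mult.commute)
    show "0 \<le> v \<bullet> (a' *v v)" for v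
    proof (cases "q = 0")
      case False
      then show ?thesis
        using nonneg[of v "- (r \<bullet> v) / q"] unfolding quad'
        by (simp add: power2_eq_square field_simps)
    qed (use quad' insert.prems(2) in simp)
    show "a' $ i $ j = 0" if "i \<notin> I" for i j
    proof (cases "i = x")
      case True
      then show ?thesis using r0 by (cases "q = 0") (auto simp: a'_def r_def q_def)
    next
      case False
      then have "a $ i $ k = 0" for k using insert.prems(3) that by auto
      then show ?thesis using sym[of i x] by (simp add: a'_def r_def)
    qed
  qed
  then obtain c where c: "\<And>i j. a' $ i $ j = (\<Sum>k\<in>I. c k $ i * c k $ j)" by blast
  define c' where "c' = c(x := (1 / sqrt q) *\<^sub>R r)"
  have "a $ i $ j = (\<Sum>k\<in>insert x I. c' k $ i * c' k $ j)" for i j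
  proof -
    have "(\<Sum>k\<in>I. c' k $ i * c' k $ j) = (\<Sum>k\<in>I. c k $ i * c k $ j)"
      using insert.hyps by (intro sum.cong) (auto simp: c'_def)
    moreover have "c' x $ i * c' x $ j = r $ i * r $ j / q"
      using \<open>0 \<le> q\<close> by (simp add: c'_def)
    ultimately show ?thesis
      using insert.hyps c[of i j] by (simp add: a'_def)
  qed
  then show ?case by blast
qed

text \<open>Restricting \<open>w\<close> to the line through \<open>z\<close> in direction
  \<open>v\<close> leaves the one-variable tests at a maximum. If the second derivative were
  positive, the first derivative would be positive just to the right of 0 and the function would
  increase there.\<close>

lemma directional_second_derivative:
  fixes w :: "real^'n \<Rightarrow> real"
  assumes "open V" "z \<in> V" "Ck_on 2 V w" "\<And>t. t \<in> V \<Longrightarrow> w t \<le> w z"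
  shows "(\<Sum>j\<in>UNIV. v $ j * partial_deriv j w z) = 0"
    and "(\<Sum>i\<in>UNIV. \<Sum>j\<in>UNIV. v $ i * v $ j * partial_deriv i (partial_deriv j w) z) \<le> 0"
proof -
  have C: "Ck_on (Suc (Suc 0)) V w" using assms(3) by (simp add: numeral_2_eq_2)
  define g where "g s = w (z + s *\<^sub>R v)" for s
  define g1 where "g1 s = (\<Sum>j\<in>UNIV. v $ j * partial_deriv j w (z + s *\<^sub>R v))" for s
  have line: "((\<lambda>s. z + s *\<^sub>R v) has_derivative (\<lambda>h. h *\<^sub>R v)) (at s)" for s
    by (auto intro!: derivative_eq_intros)
  have chain: "((\<lambda>s. f (z + s *\<^sub>R v)) has_field_derivative
      (\<Sum>i\<in>UNIV. v $ i * partial_deriv i f (z + s *\<^sub>R v))) (at s)"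
    if "f differentiable (at (z + s *\<^sub>R v))" for f :: "real^'n \<Rightarrow> real" and s
    by (rule has_derivative_imp_has_field_derivative[OF
        has_derivative_compose[OF line has_derivative_partial[OF that]]])
      (simp add: sum_distrib_left mult_ac)
  have "open ((\<lambda>s. z + s *\<^sub>R v) -` V)"
    by (intro open_vimage assms(1) continuous_intros)
  moreover have "0 \<in> (\<lambda>s. z + s *\<^sub>R v) -` V" using assms(2) by simp
  ultimately obtain e where "e > 0" and sub: "ball 0 e \<subseteq> (\<lambda>s. z + s *\<^sub>R v) -` V"
    using openE by blast
  have e: "e > 0" "\<And>s. \<bar>s\<bar> < e \<Longrightarrow> z + s *\<^sub>R v \<in> V"
    using \<open>e > 0\<close> sub by (auto simp: subset_iff)
  have g: "(g has_field_derivative g1 s) (at s)" if "\<bar>s\<bar> < e" for s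
    unfolding g_def g1_def using e(2)[OF that] C by (intro chain) simp
  have diff: "partial_deriv j w differentiable (at z)" for j
    using Ck_on_imp_differentiable[OF Ck_on_partial_deriv[OF C]] assms(2) by blast
  have g1: "(g1 has_field_derivative
      (\<Sum>j\<in>UNIV. v $ j * (\<Sum>i\<in>UNIV. v $ i * partial_deriv i (partial_deriv j w) z))) (at 0)"
    unfolding g1_def
    by (rule DERIV_sum, rule DERIV_cmult) (use chain[of _ 0] diff in auto)
  have max: "g s \<le> g 0" if "\<bar>s\<bar> < e" for s
    using e(2)[OF that] assms(4) by (simp add: g_def)
  have "g1 0 = 0"
    using DERIV_local_max[OF g[of 0] e(1)] max e(1) by auto
  then show "(\<Sum>j\<in>UNIV. v $ j * partial_deriv j w z) = 0" by (simp add: g1_def)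
  have "(\<Sum>j\<in>UNIV. v $ j * (\<Sum>i\<in>UNIV. v $ i * partial_deriv i (partial_deriv j w) z)) \<le> 0"
  proof (rule ccontr)
    assume "\<not> ?thesis"
    then obtain d where d: "d > 0" "\<And>h. 0 < h \<Longrightarrow> h < d \<Longrightarrow> g1 0 < g1 (0 + h)"
      using DERIV_pos_inc_right[OF g1] by force
    define h where "h = min d e / 2"
    have h: "0 < h" "h < d" "h < e" using d(1) e(1) by (auto simp: h_def)
    have "g 0 < g h"
    proof (rule DERIV_pos_imp_increasing_open[OF h(1)])
      show "\<exists>y. DERIV g s :> y \<and> y > 0" if "0 < s" "s < h" for s
        using g[of s] d(2)[of s] that h \<open>g1 0 = 0\<close> by auto
      show "continuous_on {0..h} g"
        by (intro continuous_at_imp_continuous_on ballI DERIV_isCont[OF g]) (use h in auto)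
    qed
    then show False using max[of h] h by simp
  qed
  moreover have "(\<Sum>j\<in>UNIV. v $ j * (\<Sum>i\<in>UNIV. v $ i * partial_deriv i (partial_deriv j w) z))
      = (\<Sum>i\<in>UNIV. \<Sum>j\<in>UNIV. v $ i * v $ j * partial_deriv i (partial_deriv j w) z)"
    by (subst sum.swap) (simp add: sum_distrib_left mult_ac)
  ultimately show "(\<Sum>i\<in>UNIV. \<Sum>j\<in>UNIV. v $ i * v $ j * partial_deriv i (partial_deriv j w) z) \<le> 0"
    by simp
qed

section \<open>Second-order operators\<close>

text \<open>The coefficients are values at one point rather than functions, since the operator is
  always evaluated pointwise. The general codomain lets one operator act on a complex function and
  on its real and imaginary parts.\<close>

definition elliptic_op ::
    "real^'n^'n \<Rightarrow> real^'n \<Rightarrow> (real^'n \<Rightarrow> 'b::real_normed_vector) \<Rightarrow> real^'n \<Rightarrow> 'b" where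
  "elliptic_op a b u t = (\<Sum>i\<in>UNIV. \<Sum>j\<in>UNIV. a $ i $ j *\<^sub>R partial_deriv i (partial_deriv j u) t)
     + (\<Sum>l\<in>UNIV. b $ l *\<^sub>R partial_deriv l u t)"

text \<open>When \<open>a\<close> is the inverse metric, this is the bilinear product of the
  gradients of \<open>u\<close> and \<open>v\<close>.\<close>

definition grad_prod ::
    "real^'n^'n \<Rightarrow> (real^'n \<Rightarrow> 'b::real_normed_algebra) \<Rightarrow> (real^'n \<Rightarrow> 'b) \<Rightarrow> real^'n \<Rightarrow> 'b" where
  "grad_prod a u v t = (\<Sum>i\<in>UNIV. \<Sum>j\<in>UNIV. a $ i $ j *\<^sub>R (partial_deriv i u t * partial_deriv j v t))"

lemma Ck_on_2_D:
  assumes "Ck_on 2 V u" "t \<in> V"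
  shows "u differentiable (at t)" "partial_deriv i u differentiable (at t)"
proof -
  have C: "Ck_on (Suc (Suc 0)) V u" using assms(1) by (simp add: numeral_2_eq_2)
  then show "u differentiable (at t)" using assms(2) by simp
  show "partial_deriv i u differentiable (at t)"
    using Ck_on_imp_differentiable[OF Ck_on_partial_deriv[OF C]] assms(2) by blast
qed

lemma partial_deriv2_cong:
  assumes "open V" "t \<in> V" "\<And>s. s \<in> V \<Longrightarrow> partial_deriv j u s = v s"
  shows "partial_deriv i (partial_deriv j u) t = partial_deriv i v t"
  by (rule partial_deriv_cong[OF assms])

lemma elliptic_op_cong:
  assumes "open V" "t \<in> V" "\<And>s. s \<in> V \<Longrightarrow> u s = v s"
  shows "elliptic_op a b u t = elliptic_op a b v t"
proof -
  have 1: "partial_deriv j u s = partial_deriv j v s" if "s \<in> V" for j s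
    by (rule partial_deriv_cong[OF assms(1) that assms(3)])
  have "partial_deriv i (partial_deriv j u) t = partial_deriv i (partial_deriv j v) t" for i j
    by (rule partial_deriv_cong[OF assms(1,2) 1])
  then show ?thesis using 1[OF assms(2)] by (simp add: elliptic_op_def)
qed

lemma elliptic_op_add:
  assumes "open V" "t \<in> V" "Ck_on 2 V u" "Ck_on 2 V v"
  shows "elliptic_op a b (\<lambda>s. u s + v s) t = elliptic_op a b u t + elliptic_op a b v t"
proof -
  have 1: "partial_deriv j (\<lambda>s. u s + v s) s = partial_deriv j u s + partial_deriv j v s" if "s \<in> V" for j s
    by (intro partial_deriv_add Ck_on_2_D[OF assms(3) that] Ck_on_2_D[OF assms(4) that])
  have "partial_deriv i (partial_deriv j (\<lambda>s. u s + v s)) t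
      = partial_deriv i (partial_deriv j u) t + partial_deriv i (partial_deriv j v) t" for i j
    by (rule partial_deriv2_cong[OF assms(1,2) 1, THEN trans], assumption)
      (intro partial_deriv_add Ck_on_2_D[OF assms(3,2)] Ck_on_2_D[OF assms(4,2)])
  then show ?thesis using 1[OF assms(2)]
    by (simp add: elliptic_op_def scaleR_add_right sum.distrib)
qed

lemma elliptic_op_bounded_linear:
  assumes "bounded_linear h" "open V" "t \<in> V" "Ck_on 2 V u"
  shows "elliptic_op a b (\<lambda>s. h (u s)) t = h (elliptic_op a b u t)"
proof -
  interpret bounded_linear h by fact
  have 1: "partial_deriv j (\<lambda>s. h (u s)) s = h (partial_deriv j u s)" if "s \<in> V" for j s
    by (intro partial_deriv_bounded_linear assms(1) Ck_on_2_D[OF assms(4) that])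
  have "partial_deriv i (partial_deriv j (\<lambda>s. h (u s))) t
      = h (partial_deriv i (partial_deriv j u) t)" for i j
    by (rule partial_deriv2_cong[OF assms(2,3) 1, THEN trans], assumption)
      (intro partial_deriv_bounded_linear assms(1) Ck_on_2_D[OF assms(4,3)])
  then show ?thesis using 1[OF assms(3)]
    by (simp add: elliptic_op_def add sum scaleR)
qed

lemma partial_deriv_scaleR:
  assumes "f differentiable (at t)" "g differentiable (at t)"
  shows "partial_deriv i (\<lambda>s. f s *\<^sub>R g s) t = f t *\<^sub>R partial_deriv i g t + partial_deriv i f t *\<^sub>R g t"
  using partial_deriv_eqI[OF has_derivative_scaleR[OF assms[THEN frechet_derivative_has]]]
  by (simp add: partial_deriv_def)

text \<open>Second-order chain rule with a vector-valued outer function. It serves three times: for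
  the exponential barrier of the maximum principle, for the squares making up the squared modulus,
  and for \<open>cis\<close> of a phase.\<close>

lemma elliptic_op_compose:
  fixes \<rho> :: "real^'n \<Rightarrow> real"
  assumes "open V" "t \<in> V" "Ck_on 2 V \<rho>"
    "\<And>x. (E has_vector_derivative E' x) (at x)" "\<And>x. (E' has_vector_derivative E'' x) (at x)"
  shows "elliptic_op a b (\<lambda>s. E (\<rho> s)) t
    = elliptic_op a b \<rho> t *\<^sub>R E' (\<rho> t) + grad_prod a \<rho> \<rho> t *\<^sub>R E'' (\<rho> t)"
proof -
  note D = Ck_on_2_D[OF assms(3)]
  have 1: "partial_deriv j (\<lambda>s. E (\<rho> s)) s = partial_deriv j \<rho> s *\<^sub>R E' (\<rho> s)" if "s \<in> V" for j s
    by (rule partial_deriv_compose[OF assms(4) D(1)[OF that]])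
  have dE: "(\<lambda>s. E' (\<rho> s)) differentiable (at t)"
    by (rule has_derivative_imp_differentiable[OF has_derivative_compose[OF
        frechet_derivative_has[OF D(1)[OF assms(2)]] assms(5)[unfolded has_vector_derivative_def]]])
  have "partial_deriv i (partial_deriv j (\<lambda>s. E (\<rho> s))) t
      = partial_deriv j \<rho> t *\<^sub>R partial_deriv i \<rho> t *\<^sub>R E'' (\<rho> t)
        + partial_deriv i (partial_deriv j \<rho>) t *\<^sub>R E' (\<rho> t)" for i j
    by (rule partial_deriv2_cong[OF assms(1,2) 1, THEN trans], assumption) (subst partial_deriv_scaleR,
      auto simp: D assms(2) dE partial_deriv_compose[OF assms(5) D(1)[OF assms(2)]])
  then show ?thesis using 1[OF assms(2)]
    by (simp add: elliptic_op_def grad_prod_def scaleR_add_right scaleR_add_left sum.distrib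
        scaleR_sum_left mult_ac)
qed

text \<open>Writing \<open>a\<close> as a sum of squares turns the second-order part into a sum of
  second directional derivatives, each nonpositive at a maximum; the first-order part is the
  derivative in direction \<open>b\<close> and vanishes.\<close>

lemma elliptic_op_max_le_zero:
  fixes w :: "real^'n \<Rightarrow> real"
  assumes "open V" "z \<in> V" "Ck_on 2 V w" "\<And>t. t \<in> V \<Longrightarrow> w t \<le> w z" "positive_definite a"
  shows "elliptic_op a b w z \<le> 0"
proof -
  note max = directional_second_derivative[OF assms(1-4)]
  have nn: "0 \<le> v \<bullet> (a *v v)" for v
    using assms(5) by (cases "v = 0") (auto simp: positive_definite_def less_imp_le)
  have "transpose a = a" using assms(5) by (simp add: positive_definite_def)
  then have "\<exists>c. \<forall>i j. a $ i $ j = (\<Sum>k\<in>(UNIV::'n set). c k $ i * c k $ j)"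
    by (intro psd_sum_of_squares nn) auto
  then obtain c where "\<forall>i j. a $ i $ j = (\<Sum>k\<in>(UNIV::'n set). c k $ i * c k $ j)" ..
  then have c: "a $ i $ j = (\<Sum>k\<in>(UNIV::'n set). c k $ i * c k $ j)" for i j by blast
  have "(\<Sum>i\<in>UNIV. \<Sum>j\<in>UNIV. a $ i $ j * partial_deriv i (partial_deriv j w) z)
     = (\<Sum>i\<in>UNIV. \<Sum>j\<in>UNIV. \<Sum>k\<in>UNIV. c k $ i * c k $ j * partial_deriv i (partial_deriv j w) z)"
    by (simp add: c sum_distrib_right)
  also have "\<dots> = (\<Sum>k\<in>UNIV. \<Sum>i\<in>UNIV. \<Sum>j\<in>UNIV. c k $ i * c k $ j * partial_deriv i (partial_deriv j w) z)"
    by (subst (3) sum.swap) (subst (2) sum.swap, rule refl)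
  also have "\<dots> \<le> 0"
    by (rule sum_nonpos) (rule max(2))
  finally have "(\<Sum>i\<in>UNIV. \<Sum>j\<in>UNIV. a $ i $ j * partial_deriv i (partial_deriv j w) z) \<le> 0" .
  then show ?thesis using max(1)[of b] by (simp add: elliptic_op_def)
qed

section \<open>The strong maximum principle\<close>

lemma Ck_on_ident: "open S \<Longrightarrow> Ck_on r S (\<lambda>x. x)"
proof (cases r)
  case (Suc r')
  assume "open S"
  then show ?thesis unfolding Suc
    by (intro Ck_on_SucI[where f' = "\<lambda>x v. v"] Ck_on_const) auto
qed (simp add: continuous_on_id)

text \<open>Hopf's argument. If \<open>w\<close> is below \<open>m\<close> somewhere near
  \<open>z0\<close>, a ball on which w < m touches the maximum set at a point \<open>z1\<close>.
  Adding a small multiple of a barrier that is strictly subharmonic near \<open>z1\<close> produces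
  an interior maximum in a small ball around \<open>z1\<close>, where the operator would be both
  positive and nonpositive.\<close>

lemma strong_maximum_principle:
  fixes w :: "real^'n \<Rightarrow> real" and a :: "real^'n \<Rightarrow> real^'n^'n" and b :: "real^'n \<Rightarrow> real^'n"
  assumes "open V" "Ck_on 2 V w"
    and pd: "\<And>t. t \<in> V \<Longrightarrow> positive_definite (a t)"
    and cont: "continuous_on V a" "continuous_on V b"
    and sub: "\<And>t. t \<in> V \<Longrightarrow> 0 \<le> elliptic_op (a t) (b t) w t"
    and le: "\<And>t. t \<in> V \<Longrightarrow> w t \<le> m"
    and z0: "z0 \<in> V" "w z0 = m"
  shows "\<exists>r>0. ball z0 r \<subseteq> V \<and> (\<forall>t\<in>ball z0 r. w t = m)"
proof -
  obtain r0 where r0: "r0 > 0" "ball z0 r0 \<subseteq> V"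
    using \<open>open V\<close> z0(1) openE by blast
  \<comment> \<open>A point \<open>y\<close> within \<open>r\<close> of \<open>z0\<close> has
    distance less than \<open>r\<close> to the nearest maximum, so the ball around \<open>y\<close>
    up to that maximum stays in the closed ball of radius 2 r, which a third of \<open>r0\<close>
    keeps inside \<open>V\<close>.\<close>
  define r where "r = r0 / 3"
  have r: "r > 0" "cball z0 (2 * r) \<subseteq> V" "ball z0 r \<subseteq> V"
    using r0 by (auto simp: r_def subset_iff)
  have wcont: "continuous_on V w"
    using assms(2) Ck_on_imp_continuous_on by blast
  have "w y = m" if y: "y \<in> ball z0 r" for y
  proof (rule ccontr)
    assume ne: "w y \<noteq> m"
    define S where "S = {t \<in> cball z0 (2 * r). w t = m}"
    have "closed S"
      unfolding S_def
      by (rule continuous_closed_preimage_constant) (use r(2) wcont continuous_on_subset in auto)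
    moreover have "z0 \<in> S" using r z0 by (simp add: S_def)
    ultimately obtain z1 where z1: "z1 \<in> S" "\<And>t. t \<in> S \<Longrightarrow> dist y z1 \<le> dist y t"
      using distance_attains_inf[of S y] by auto
    define R where "R = dist y z1"
    have R: "0 < R" "R < r"
      using ne z1 z1(2)[OF \<open>z0 \<in> S\<close>] y by (auto simp: R_def S_def dist_commute)
    have near: "t \<in> V \<and> w t < m" if "dist y t < R" for t
    proof -
      have "dist z0 t \<le> 2 * r"
        using dist_triangle[of z0 t y] that R y by simp
      then have "t \<in> V" using r by auto
      moreover have "t \<notin> S" using z1(2)[of t] that by (auto simp: R_def)
      ultimately show ?thesis using le[of t] \<open>dist z0 t \<le> 2 * r\<close> by (auto simp: S_def)
    qed
    have z1V: "z1 \<in> V" "w z1 = m" using z1(1) r(2) by (auto simp: S_def)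
    define q where "q = (1/2) *\<^sub>R (z1 - y)"
    define y' where "y' = y + q"
    have q: "z1 - y' = q" "norm q = R / 2" "q \<noteq> 0"
    proof -
      have "z1 - y = q + q" by (simp add: q_def flip: scaleR_add_left)
      then show "z1 - y' = q" by (simp add: y'_def algebra_simps)
      show "norm q = R / 2" by (simp add: q_def R_def dist_norm norm_minus_commute)
      then show "q \<noteq> 0" using R(1) by auto
    qed
    text \<open>Halving the ball makes \<open>z1\<close> the only point of the closed ball where the maximum is attained.\<close>
    have near': "t \<in> V \<and> w t < m" if "norm (t - y') \<le> R / 2" "t \<noteq> z1" for t
    proof (rule near)
      let ?p = "t - y'"
      \<comment> \<open>Parallelogram law: \<open>?p + q\<close> is t - y and \<open>?p - q\<close>
        is t - z1, so the distance to \<open>y\<close> is strictly below \<open>R\<close> as soon as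
        t differs from \<open>z1\<close>.\<close>
      have "(norm (?p + q))\<^sup>2 + (norm (?p - q))\<^sup>2 = 2 * (norm ?p)\<^sup>2 + 2 * (norm q)\<^sup>2"
        by (simp add: power2_norm_eq_inner inner_add_left inner_add_right inner_diff_left
            inner_diff_right algebra_simps)
      moreover have "(norm ?p)\<^sup>2 \<le> (R / 2)\<^sup>2" using that(1) by (intro power_mono) auto
      moreover have "?p - q \<noteq> 0" using that(2) q(1) by auto
      then have "0 < (norm (?p - q))\<^sup>2" by simp
      moreover have "2 * (R / 2)\<^sup>2 + 2 * (R / 2)\<^sup>2 = R\<^sup>2" by (simp add: power_divide)
      ultimately have "(norm (?p + q))\<^sup>2 < R\<^sup>2" unfolding q(2) by linarith
      then have "norm (?p + q) < R" using R(1) by (simp add: power2_less_imp_less)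
      then show "dist y t < R" by (simp add: y'_def dist_norm norm_minus_commute)
    qed
    \<comment> \<open>Positive inside the halved ball, zero on its boundary and in particular at
      \<open>z1\<close>, negative outside; its gradient at \<open>z1\<close> is nonzero.\<close>
    define \<rho> where "\<rho> t = (R / 2)\<^sup>2 - (t - y') \<bullet> (t - y')" for t
    have d\<rho>: "(\<rho> has_derivative (\<lambda>v. - 2 * ((t - y') \<bullet> v))) (at t)" for t
      unfolding \<rho>_def by (auto intro!: derivative_eq_intros simp: inner_commute)
    have \<rho>1: "partial_deriv j \<rho> t = - 2 * (t - y') $ j" for j t
      using partial_deriv_eqI[OF d\<rho>] by (simp add: inner_axis)
    have \<rho>2: "partial_deriv i (partial_deriv j \<rho>) t = - 2 * axis i 1 $ j" for i j t
    proof -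
      have "((\<lambda>t. - 2 * (t - y') $ j) has_derivative (\<lambda>v. - 2 * v $ j)) (at t)"
        by (auto intro!: derivative_eq_intros bounded_linear_imp_has_derivative)
      then show ?thesis unfolding \<rho>1[abs_def] by (rule partial_deriv_eqI)
    qed
    have C\<rho>: "Ck_on k V \<rho>" for k
    proof -
      have "Ck_on k V (\<lambda>t. (R / 2)\<^sup>2 + (t + - y') \<bullet> (- t + y'))"
        by (intro Ck_on_add Ck_on_const Ck_on_bilinear[OF bounded_bilinear_inner]
            Ck_on_ident Ck_on_bounded_linear[OF bounded_linear_minus[OF bounded_linear_ident]] \<open>open V\<close>)
      then show ?thesis
        by (rule Ck_on_cong[OF \<open>open V\<close>])
          (simp add: \<rho>_def inner_diff_left inner_diff_right algebra_simps)
    qed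
    define P where "P t = grad_prod (a t) \<rho> \<rho> t" for t
    define L where "L t = elliptic_op (a t) (b t) \<rho> t" for t
    have "P z1 = 4 * (q \<bullet> (a z1 *v q))"
      by (simp add: P_def grad_prod_def \<rho>1 quadratic_form_sum sum_distrib_left q(1) mult_ac
          del: vector_minus_component)
    then have "P z1 > 0" using pd[OF z1V(1)] q(3) by (simp add: positive_definite_def)
    \<comment> \<open>Makes \<alpha> P(z1) equal to |L(z1)| + 1, so that \<alpha> P + L is at least
      1 at \<open>z1\<close> and, by continuity, positive nearby.\<close>
    define \<alpha> where "\<alpha> = (\<bar>L z1\<bar> + 1) / P z1"
    have "\<alpha> > 0" using \<open>P z1 > 0\<close> by (simp add: \<alpha>_def)
    have "\<alpha> * P z1 + L z1 > 0" using \<open>P z1 > 0\<close> by (simp add: \<alpha>_def)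
    moreover have "continuous_on V (\<lambda>t. \<alpha> * P t + L t)"
      unfolding P_def L_def grad_prod_def elliptic_op_def \<rho>1 \<rho>2
      by (intro continuous_intros cont)
    then have "open {t \<in> V. \<alpha> * P t + L t > 0}"
      using continuous_open_preimage[OF _ \<open>open V\<close> open_greaterThan[of 0]]
      by (simp add: vimage_def Int_def)
    ultimately obtain e where e: "e > 0" "cball z1 e \<subseteq> {t \<in> V. \<alpha> * P t + L t > 0}"
      using z1V(1) by (metis (mono_tags, lifting) mem_Collect_eq open_contains_cball)
    \<comment> \<open>On the part of the small sphere inside the halved ball the barrier exceeds its
      value at \<open>z1\<close> or equals it, so a gap of \<open>w\<close> below \<open>m\<close>
      is required; it exists by compactness, since \<open>z1\<close> is not on the sphere.\<close>
    define K where "K = sphere z1 e \<inter> cball y' (R / 2)"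
    have "\<exists>d>0. \<forall>t\<in>K. w t \<le> m - d"
    proof (cases "K = {}")
      case False
      have "compact K" by (auto simp: K_def intro: compact_Int_closed)
      moreover have "continuous_on K w"
        using e(2) by (intro continuous_on_subset[OF wcont]) (auto simp: K_def)
      ultimately obtain t0 where t0: "t0 \<in> K" "\<And>t. t \<in> K \<Longrightarrow> w t \<le> w t0"
        using continuous_attains_sup[of K w] False by auto
      have "w t0 < m"
        using near'[of t0] t0(1) e(1) by (auto simp: K_def dist_norm norm_minus_commute)
      then show ?thesis using t0(2) by (intro exI[of _ "m - w t0"]) auto
    qed (auto intro: exI[of _ 1])
    then obtain d where d: "d > 0" "\<And>t. t \<in> K \<Longrightarrow> w t \<le> m - d" by blast
    \<comment> \<open>As \<rho> is at most (R / 2)^2, this keeps \<open>h\<close> below d / 2 on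
      \<open>K\<close>, less than the gap \<open>d\<close>.\<close>
    define \<epsilon> where "\<epsilon> = d / (2 * exp (\<alpha> * (R / 2)\<^sup>2))"
    have "\<epsilon> > 0" using d(1) by (simp add: \<epsilon>_def)
    define h where "h t = \<epsilon> * exp (\<alpha> * \<rho> t)" for t
    define W where "W t = w t + h t" for t
    have "\<rho> z1 = 0" by (simp add: \<rho>_def dot_square_norm q(1,2))
    then have Wz1: "W z1 = m + \<epsilon>" by (simp add: W_def h_def z1V)
    have sphere: "W t < m + \<epsilon>" if "t \<in> sphere z1 e" for t
    proof (cases "t \<in> K")
      case True
      have "\<rho> t \<le> (R / 2)\<^sup>2" by (simp add: \<rho>_def)
      then have "h t \<le> \<epsilon> * exp (\<alpha> * (R / 2)\<^sup>2)"
        using \<open>\<epsilon> > 0\<close> \<open>\<alpha> > 0\<close> by (simp add: h_def)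
      also have "\<dots> = d / 2" by (simp add: \<epsilon>_def)
      finally show ?thesis using d(2)[OF True] \<open>\<epsilon> > 0\<close> d(1) by (simp add: W_def)
    next
      case False
      then have "R / 2 < norm (t - y')"
        using that by (simp add: K_def dist_norm norm_minus_commute)
      then have "(R / 2)\<^sup>2 < (norm (t - y'))\<^sup>2" using R(1) by (intro power_strict_mono) auto
      then have "\<rho> t < 0" by (simp add: \<rho>_def dot_square_norm)
      then have "h t < \<epsilon>" using \<open>\<epsilon> > 0\<close> \<open>\<alpha> > 0\<close> by (simp add: h_def mult_pos_neg)
      moreover have "w t \<le> m" using e(2) that le[of t] by (auto simp: subset_iff)
      ultimately show ?thesis by (simp add: W_def)
    qed
    have E1: "((\<lambda>x. \<epsilon> * exp (\<alpha> * x)) has_vector_derivative \<epsilon> * \<alpha> * exp (\<alpha> * x)) (at x)" for x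
      unfolding has_real_derivative_iff_has_vector_derivative[symmetric]
      by (auto intro!: derivative_eq_intros)
    have E2: "((\<lambda>x. \<epsilon> * \<alpha> * exp (\<alpha> * x)) has_vector_derivative \<epsilon> * \<alpha>\<^sup>2 * exp (\<alpha> * x)) (at x)" for x
      unfolding has_real_derivative_iff_has_vector_derivative[symmetric]
      by (auto intro!: derivative_eq_intros simp: power2_eq_square)
    \<comment> \<open>The factor \<alpha> P + L, positive near \<open>z1\<close>, is what the
      gradient term and the drift leave after the exponential is taken out.\<close>
    have Lh: "elliptic_op (a t) (b t) h t = h t * \<alpha> * (\<alpha> * P t + L t)" if "t \<in> V" for t
      using elliptic_op_compose[OF \<open>open V\<close> that C\<rho> E1 E2, of "a t" "b t"]
      by (simp add: h_def[abs_def] P_def L_def power2_eq_square algebra_simps)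
    have "Ck_on 2 V (\<lambda>t. exp (\<alpha> * \<rho> t))"
      unfolding numeral_2_eq_2
    proof (rule Ck_on_SucI[OF \<open>open V\<close>])
      show e1: "((\<lambda>t. exp (\<alpha> * \<rho> t)) has_derivative (\<lambda>v. exp (\<alpha> * \<rho> t) * (\<alpha> * (- 2 * ((t - y') \<bullet> v))))) (at t)" for t
        by (auto intro!: derivative_eq_intros d\<rho>)
      show "Ck_on (Suc 0) V (\<lambda>t. exp (\<alpha> * \<rho> t) * (\<alpha> * (- 2 * ((t - y') \<bullet> v))))" for v
      proof (rule Ck_on_SucI[OF \<open>open V\<close>])
        show "((\<lambda>t. exp (\<alpha> * \<rho> t) * (\<alpha> * (- 2 * ((t - y') \<bullet> v)))) has_derivative
           (\<lambda>u. exp (\<alpha> * \<rho> t) * (\<alpha> * (- 2 * (u \<bullet> v)))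
              + (exp (\<alpha> * \<rho> t) * (\<alpha> * (- 2 * ((t - y') \<bullet> u)))) * (\<alpha> * (- 2 * ((t - y') \<bullet> v))))) (at t)" for t
          by (rule has_derivative_mult[OF e1]) (auto intro!: derivative_eq_intros)
        have "continuous_on V \<rho>" using C\<rho>[of 0] by simp
        then show "Ck_on 0 V (\<lambda>t. exp (\<alpha> * \<rho> t) * (\<alpha> * (- 2 * (u \<bullet> v)))
              + (exp (\<alpha> * \<rho> t) * (\<alpha> * (- 2 * ((t - y') \<bullet> u)))) * (\<alpha> * (- 2 * ((t - y') \<bullet> v))))" for u
          by (auto intro!: continuous_intros)
      qed
    qed
    then have Ch: "Ck_on 2 V h"
      unfolding h_def[abs_def]
      by (intro Ck_on_bounded_linear[OF bounded_linear_mult_right] \<open>open V\<close>)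
    then have CW: "Ck_on 2 V W"
      unfolding W_def[abs_def] by (intro Ck_on_add \<open>open V\<close> assms(2))
    have "continuous_on (cball z1 e) W"
      using e(2) by (intro continuous_on_subset[OF Ck_on_imp_continuous_on[OF CW]]) auto
    then obtain p where p: "p \<in> cball z1 e" "\<And>t. t \<in> cball z1 e \<Longrightarrow> W t \<le> W p"
      using continuous_attains_sup[of "cball z1 e" W] e(1) by auto
    have "W p \<ge> m + \<epsilon>" using p(2)[of z1] Wz1 e(1) by simp
    then have pb: "p \<in> ball z1 e" using sphere[of p] p(1) by force
    have pV: "p \<in> V" and pos: "\<alpha> * P p + L p > 0" using p(1) e(2) by auto
    have ballV: "ball z1 e \<subseteq> V" using e(2) ball_subset_cball[of z1 e] by blast
    \<comment> \<open>Since W(z1) = m + \<epsilon> beats all values on the sphere, the maximum point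
      \<open>p\<close> is interior and the second-derivative test applies to it.\<close>
    have "elliptic_op (a p) (b p) W p \<le> 0"
      by (rule elliptic_op_max_le_zero[OF open_ball pb Ck_on_subset[OF CW ballV]])
        (use p(2) pd[OF pV] in auto)
    moreover have "elliptic_op (a p) (b p) W p
        = elliptic_op (a p) (b p) w p + h p * \<alpha> * (\<alpha> * P p + L p)"
      unfolding W_def[abs_def]
      using elliptic_op_add[OF \<open>open V\<close> pV assms(2) Ch] Lh[OF pV] by simp
    moreover have "h p * \<alpha> * (\<alpha> * P p + L p) > 0"
      using \<open>\<epsilon> > 0\<close> \<open>\<alpha> > 0\<close> pos by (simp add: h_def)
    ultimately show False using sub[OF pV] by linarith
  qed
  then show ?thesis using r by blast
qed

section \<open>The Laplacian of a metric in coordinates\<close>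

lemma positive_definite_invertible:
  assumes "positive_definite G"
  shows "invertible G"
proof -
  have "x = 0" if "G *v x = 0" for x
    using assms that by (auto simp: positive_definite_def dest!: spec[of _ x])
  then show ?thesis
    by (simp add: invertible_left_inverse matrix_left_invertible_ker)
qed

lemma matrix_inv_mult:
  fixes G :: "'a::field^'n^'n"
  assumes "invertible G"
  shows "G ** matrix_inv G = mat 1" "matrix_inv G ** G = mat 1"
proof -
  have "\<exists>B. G ** B = mat 1 \<and> B ** G = mat 1"
    using assms by (simp add: invertible_def)
  from someI_ex[OF this] show "G ** matrix_inv G = mat 1" "matrix_inv G ** G = mat 1"
    by (auto simp: matrix_inv_def)
qed

lemma transpose_matrix_inv:
  fixes G :: "'a::field^'n^'n"
  assumes "invertible G" "transpose G = G"
  shows "transpose (matrix_inv G) = matrix_inv G"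
proof -
  have "transpose (matrix_inv G) ** G = mat 1"
    using arg_cong[OF matrix_inv_mult(1)[OF assms(1)], of transpose]
    by (simp add: matrix_transpose_mul assms(2))
  then have "transpose (matrix_inv G) ** (G ** matrix_inv G) = matrix_inv G"
    by (simp add: matrix_mul_assoc)
  then show ?thesis by (simp add: matrix_inv_mult assms(1))
qed

lemma positive_definite_matrix_inv:
  assumes "positive_definite G"
  shows "positive_definite (matrix_inv G)"
proof -
  have inv: "invertible G" using assms positive_definite_invertible by blast
  have "0 < v \<bullet> (matrix_inv G *v v)" if "v \<noteq> 0" for v
  proof -
    define u where "u = matrix_inv G *v v"
    have v: "v = G *v u"
      by (simp add: u_def matrix_vector_mul_assoc matrix_inv_mult inv)
    have "u \<noteq> 0" using that v by auto
    then have "0 < u \<bullet> (G *v u)" using assms by (simp add: positive_definite_def)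
    then show ?thesis using v u_def inner_commute by metis
  qed
  then show ?thesis
    using assms transpose_matrix_inv[OF inv] by (simp add: positive_definite_def)
qed

text \<open>Cramer's rule. It exhibits each entry of the inverse as a quotient of polynomials in the
  entries of \<open>G\<close>, which yields differentiability of the inverse metric.\<close>

lemma matrix_inv_entry:
  fixes G :: "'a::field^'n^'n"
  assumes "invertible G"
  shows "matrix_inv G $ k $ l = det (\<chi> i j. if j = k then axis l 1 $ i else G $ i $ j) / det G"
proof -
  have "G *v (matrix_inv G *v axis l 1) = axis l 1"
    by (simp add: matrix_vector_mul_assoc matrix_inv_mult assms)
  then have "matrix_inv G *v axis l 1
      = (\<chi> k. det (\<chi> i j. if j = k then axis l 1 $ i else G $ i $ j) / det G)"
    using cramer[of G] assms invertible_det_nz by blast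
  then have "(matrix_inv G *v axis l 1) $ k
      = det (\<chi> i j. if j = k then axis l 1 $ i else G $ i $ j) / det G" by simp
  moreover have "(matrix_inv G *v axis l 1) $ k = (\<Sum>j\<in>UNIV. if j = l then matrix_inv G $ k $ j else 0)"
    unfolding matrix_vector_mult_def axis_def vec_lambda_beta by (rule sum.cong) simp_all
  ultimately show ?thesis by simp
qed

lemma det_differentiable:
  fixes G :: "'a::real_normed_vector \<Rightarrow> real^'n^'n"
  assumes "\<And>i j. (\<lambda>s. G s $ i $ j) differentiable (at t)"
  shows "(\<lambda>s. det (G s)) differentiable (at t)"
proof -
  have "(\<lambda>s. \<Prod>i\<in>I. G s $ i $ p i) differentiable (at t)" for p I
    by (rule has_derivative_imp_differentiable[OF has_derivative_prod])
      (rule frechet_derivative_has[OF assms])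
  then show ?thesis
    unfolding det_def by (intro differentiable_sum ballI differentiable_mult) auto
qed

lemma matrix_inv_differentiable:
  fixes G :: "'a::real_normed_vector \<Rightarrow> real^'n^'n"
  assumes "open V" "t \<in> V" "\<And>s. s \<in> V \<Longrightarrow> invertible (G s)"
    "\<And>i j. (\<lambda>s. G s $ i $ j) differentiable (at t)"
  shows "(\<lambda>s. matrix_inv (G s) $ k $ l) differentiable (at t)"
proof -
  have "(\<lambda>s. det (\<chi> i j. if j = k then axis l 1 $ i else G s $ i $ j) / det (G s)) differentiable (at t)"
  proof (intro differentiable_divide det_differentiable assms(4))
    show "(\<lambda>s. (\<chi> i j. if j = k then axis l 1 $ i else G s $ i $ j) $ i $ j) differentiable (at t)" for i j
      using assms(4)[of i j] by (cases "j = k") simp_all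
    show "det (G t) \<noteq> 0" using assms(2,3) invertible_det_nz by blast
  qed
  then obtain D where "((\<lambda>s. det (\<chi> i j. if j = k then axis l 1 $ i else G s $ i $ j) / det (G s))
      has_derivative D) (at t)" by (auto simp: differentiable_def)
  then have "((\<lambda>s. matrix_inv (G s) $ k $ l) has_derivative D) (at t)"
    by (rule has_derivative_transform_within_open[OF _ assms(1,2)])
      (simp add: matrix_inv_entry assms(3))
  then show ?thesis by (rule has_derivative_imp_differentiable)
qed

text \<open>Differentiate G G^-1 = 1 and multiply by G^-1 from the left.\<close>

lemma partial_deriv_matrix_inv:
  fixes G :: "real^'n \<Rightarrow> real^'m^'m"
  assumes "open V" "t \<in> V" "\<And>s. s \<in> V \<Longrightarrow> invertible (G s)"
    "\<And>i j. (\<lambda>s. G s $ i $ j) differentiable (at t)"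
  shows "partial_deriv k (\<lambda>s. matrix_inv (G s) $ i $ j) t
    = - (\<Sum>m\<in>UNIV. \<Sum>n\<in>UNIV. matrix_inv (G t) $ i $ m * partial_deriv k (\<lambda>s. G s $ m $ n) t
          * matrix_inv (G t) $ n $ j)"
proof -
  note dinv = matrix_inv_differentiable[OF assms]
  define dG where "dG = (\<chi> i j. partial_deriv k (\<lambda>s. G s $ i $ j) t)"
  define dA where "dA = (\<chi> i j. partial_deriv k (\<lambda>s. matrix_inv (G s) $ i $ j) t)"
  have "G t ** dA + dG ** matrix_inv (G t) = 0"
  proof -
    have "(\<Sum>m\<in>UNIV. G t $ i $ m * partial_deriv k (\<lambda>s. matrix_inv (G s) $ m $ j) t
        + partial_deriv k (\<lambda>s. G s $ i $ m) t * matrix_inv (G t) $ m $ j) = 0" for i j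
    proof -
      have "(\<Sum>m\<in>UNIV. G t $ i $ m * partial_deriv k (\<lambda>s. matrix_inv (G s) $ m $ j) t
          + partial_deriv k (\<lambda>s. G s $ i $ m) t * matrix_inv (G t) $ m $ j)
        = partial_deriv k (\<lambda>s. \<Sum>m\<in>UNIV. G s $ i $ m * matrix_inv (G s) $ m $ j) t"
        by (subst partial_deriv_sum) (simp_all add: assms(4) dinv differentiable_mult partial_deriv_mult)
      also have "\<dots> = partial_deriv k (\<lambda>s. (mat 1 :: real^'m^'m) $ i $ j) t"
      proof (rule partial_deriv_cong[OF assms(1,2)])
        fix s assume "s \<in> V"
        then show "(\<Sum>m\<in>UNIV. G s $ i $ m * matrix_inv (G s) $ m $ j) = (mat 1 :: real^'m^'m) $ i $ j"
          using matrix_inv_mult(1)[OF assms(3)] by (metis (no_types, lifting) matrix_matrix_mult_def vec_lambda_beta sum.cong)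
      qed
      also have "\<dots> = 0"
        using partial_deriv_eqI[OF has_derivative_const] .
      finally show ?thesis .
    qed
    then show ?thesis
      by (simp add: vec_eq_iff matrix_matrix_mult_def dA_def dG_def flip: sum.distrib)
  qed
  then have "G t ** dA = - (dG ** matrix_inv (G t))" by (simp add: eq_neg_iff_add_eq_0)
  then have "matrix_inv (G t) ** (G t ** dA) = matrix_inv (G t) ** (- (dG ** matrix_inv (G t)))" by simp
  moreover have "matrix_inv (G t) ** (G t ** dA) = dA"
    by (simp add: matrix_mul_assoc matrix_inv_mult assms(2,3))
  moreover have "X ** (- Y) = - (X ** Y)" for X Y :: "real^'m^'m"
    by (simp add: matrix_matrix_mult_def vec_eq_iff sum_negf)
  ultimately have "dA = - (matrix_inv (G t) ** (dG ** matrix_inv (G t)))" by simp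
  then have "dA $ i $ j = - ((matrix_inv (G t) ** (dG ** matrix_inv (G t))) $ i $ j)" by simp
  then show ?thesis
    by (simp add: dA_def dG_def matrix_matrix_mult_def sum_distrib_left mult_ac)
qed

text \<open>This is \<open>\<nabla>\<^sub>i g\<^sup>i\<^sup>l = 0\<close>: it identifies the first-order coefficients of the divergence form of the
  Laplacian with those of the trace of the Hessian.\<close>

lemma christoffel_trace_identity:
  fixes a :: "'n::finite \<Rightarrow> 'n \<Rightarrow> real" and d :: "'n \<Rightarrow> 'n \<Rightarrow> 'n \<Rightarrow> real"
  assumes a: "\<And>i j. a i j = a j i" and d: "\<And>k i j. d k i j = d k j i"
    and \<Gamma>: "\<And>l i j. \<Gamma> l i j = (1 / 2) * (\<Sum>m\<in>UNIV. a l m * (d i m j + d j m i - d m i j))"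
  shows "(\<Sum>i\<in>UNIV. - (\<Sum>m\<in>UNIV. \<Sum>n\<in>UNIV. a i m * d i m n * a n l))
      + (\<Sum>i\<in>UNIV. \<Sum>j\<in>UNIV. \<Gamma> i i j * a j l) = - (\<Sum>i\<in>UNIV. \<Sum>j\<in>UNIV. a i j * \<Gamma> l i j)"
proof -
  define T where "T f = (\<Sum>i\<in>UNIV. \<Sum>j\<in>UNIV. \<Sum>m\<in>UNIV. f i j m :: real)" for f :: "'n \<Rightarrow> 'n \<Rightarrow> 'n \<Rightarrow> real"
  have T12: "T f = T (\<lambda>i j m. f j i m)" for f unfolding T_def by (rule sum.swap)
  have T23: "T f = T (\<lambda>i j m. f i m j)" for f
    unfolding T_def by (rule sum.cong[OF refl], rule sum.swap)
  have Tadd: "T (\<lambda>i j m. f i j m + g i j m) = T f + T g" for f g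
    by (simp add: T_def sum.distrib)
  have Tdiff: "T (\<lambda>i j m. f i j m - g i j m) = T f - T g" for f g
    by (simp add: T_def sum_subtractf)
  have Tcong: "T f = T g" if "\<And>i j m. f i j m = g i j m" for f g
    using that by (simp add: T_def)
  \<comment> \<open>Each side expands into such triple sums. Relabelling the indices and the
    symmetries of \<open>a\<close> and \<open>d\<close> give Q = P, Y = R and X = Z, after which
    both sides are R / 2 - P.\<close>
  define P where "P = T (\<lambda>i j m. a i j * a l m * d i m j)"
  define Q where "Q = T (\<lambda>i j m. a i j * a l m * d j m i)"
  define R where "R = T (\<lambda>i j m. a i j * a l m * d m i j)"
  define X where "X = T (\<lambda>i j m. a i m * a j l * d i m j)"
  define Y where "Y = T (\<lambda>i j m. a i m * a j l * d j m i)"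
  define Z where "Z = T (\<lambda>i j m. a i m * a j l * d m i j)"
  have "Q = P" unfolding P_def Q_def by (subst T12) (rule Tcong, metis a d)
  have "Y = R" unfolding Y_def R_def by (subst T23) (rule Tcong, metis a d)
  have "X = Z" unfolding X_def Z_def by (subst T23, subst T12, subst T23) (rule Tcong, metis a d)
  have 1: "(\<Sum>i\<in>UNIV. - (\<Sum>m\<in>UNIV. \<Sum>n\<in>UNIV. a i m * d i m n * a n l)) = - P"
    unfolding P_def T_def sum_negf[symmetric]
    by (intro sum.cong refl) (metis a d mult.assoc mult.commute)
  have "\<Gamma> i i j * a j l
      = (\<Sum>m\<in>UNIV. a i m * a j l * d i m j + a i m * a j l * d j m i - a i m * a j l * d m i j) / 2" for i j
    unfolding \<Gamma> sum_distrib_left sum_distrib_right sum_divide_distrib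
    by (rule sum.cong) (simp_all add: field_simps)
  then have 2: "(\<Sum>i\<in>UNIV. \<Sum>j\<in>UNIV. \<Gamma> i i j * a j l) = (X + Y - Z) / 2"
    unfolding X_def Y_def Z_def Tadd[symmetric] Tdiff[symmetric]
    by (simp only: T_def sum_divide_distrib)
  have "a i j * \<Gamma> l i j
      = (\<Sum>m\<in>UNIV. a i j * a l m * d i m j + a i j * a l m * d j m i - a i j * a l m * d m i j) / 2" for i j
    unfolding \<Gamma> sum_distrib_left sum_distrib_right sum_divide_distrib
    by (rule sum.cong) (simp_all add: field_simps)
  then have 3: "(\<Sum>i\<in>UNIV. \<Sum>j\<in>UNIV. a i j * \<Gamma> l i j) = (P + Q - R) / 2"
    unfolding P_def Q_def R_def Tadd[symmetric] Tdiff[symmetric]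
    by (simp only: T_def sum_divide_distrib)
  show ?thesis unfolding 1 2 3 using \<open>Q = P\<close> \<open>Y = R\<close> \<open>X = Z\<close>
    by (simp add: diff_divide_distrib)
qed

text \<open>The coefficient of the first derivatives in the trace of the Hessian, so that
  \<open>laplacian\<close> below is the Laplace-Beltrami operator in non-divergence form.\<close>

definition metric_drift :: "(real^'n \<Rightarrow> real^'n^'n) \<Rightarrow> real^'n \<Rightarrow> real^'n" where
  "metric_drift G t =
    (\<chi> l. - (\<Sum>i\<in>UNIV. \<Sum>j\<in>UNIV. matrix_inv (G t) $ i $ j * christoffel G l i j t))"

abbreviation laplacian ::
    "(real^'n \<Rightarrow> real^'n^'n) \<Rightarrow> (real^'n \<Rightarrow> 'b::real_normed_vector) \<Rightarrow> real^'n \<Rightarrow> 'b" where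
  "laplacian G u t \<equiv> elliptic_op (matrix_inv (G t)) (metric_drift G t) u t"

lemma partial_deriv_const: "partial_deriv i (\<lambda>s. c) t = 0"
  by (rule partial_deriv_eqI[OF has_derivative_const])

text \<open>A constant target metric has vanishing Christoffel symbols, so the quadratic term of the
  tension field disappears and the components decouple.\<close>

lemma tension_flat_target:
  "tension G (\<lambda>_. H) F t $ a = laplacian G (\<lambda>s. F s $ a) t"
proof -
  have flat: "christoffel (\<lambda>_. H) a b c s = 0" for a b c s
    by (simp add: christoffel_def partial_deriv_const)
  have "(\<Sum>i\<in>UNIV. \<Sum>j\<in>UNIV. matrix_inv (G t) $ i $ j *
      (\<Sum>l\<in>UNIV. christoffel G l i j t * partial_deriv l (\<lambda>s. F s $ a) t))
    = (\<Sum>l\<in>UNIV. (\<Sum>i\<in>UNIV. \<Sum>j\<in>UNIV. matrix_inv (G t) $ i $ j * christoffel G l i j t)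
        * partial_deriv l (\<lambda>s. F s $ a) t)" (is "?L = ?R")
  proof -
    have "?L = (\<Sum>i\<in>UNIV. \<Sum>j\<in>UNIV. \<Sum>l\<in>UNIV. matrix_inv (G t) $ i $ j * christoffel G l i j t
        * partial_deriv l (\<lambda>s. F s $ a) t)"
      by (simp add: sum_distrib_left mult_ac)
    also have "\<dots> = (\<Sum>l\<in>UNIV. \<Sum>i\<in>UNIV. \<Sum>j\<in>UNIV. matrix_inv (G t) $ i $ j * christoffel G l i j t
        * partial_deriv l (\<lambda>s. F s $ a) t)"
      by (subst sum.swap[of _ _ "UNIV :: 'n set"], subst (2) sum.swap) (rule refl)
    also have "\<dots> = ?R" by (simp add: sum_distrib_right)
    finally show ?thesis .
  qed
  then show ?thesis
    by (simp add: tension_def second_fundamental_form_def flat elliptic_op_def metric_drift_def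
        right_diff_distrib sum_subtractf sum_negf)
qed

text \<open>The components of the differential, a covector; the Riemannian gradient would carry an
  additional inverse metric.\<close>

definition pgrad :: "(real^'n \<Rightarrow> real) \<Rightarrow> real^'n \<Rightarrow> real^'n" where
  "pgrad u t = (\<chi> i. partial_deriv i u t)"

lemma grad_prod_pgrad: "grad_prod a u v t = pgrad u t \<bullet> (a *v pgrad v t)"
  by (simp add: grad_prod_def pgrad_def quadratic_form_sum)

lemma symmetric_entry: "transpose a = a \<Longrightarrow> a $ i $ j = a $ j $ i"
  using transpose_def[of a] vec_lambda_beta by (metis (no_types, lifting))

text \<open>Detached from the manifold, so that it can also be used on the open part of a chart on
  which a phase is defined.\<close>

locale chart_metric =
  fixes V :: "(real^'n) set" and G :: "real^'n \<Rightarrow> real^'n^'n"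
  assumes open_V: "open V"
    and smooth_G: "\<And>i j. smooth_on V (\<lambda>t. G t $ i $ j)"
    and pos_def: "\<And>t. t \<in> V \<Longrightarrow> positive_definite (G t)"
begin

lemma invertible_G: "t \<in> V \<Longrightarrow> invertible (G t)"
  using pos_def positive_definite_invertible by blast

lemma Ck_on_G: "Ck_on r V (\<lambda>t. G t $ i $ j)"
  using smooth_G by (simp add: smooth_on_def)

lemma differentiable_G: "t \<in> V \<Longrightarrow> (\<lambda>s. G s $ i $ j) differentiable (at t)"
  using Ck_on_imp_differentiable Ck_on_G by blast

lemma differentiable_inv: "t \<in> V \<Longrightarrow> (\<lambda>s. matrix_inv (G s) $ i $ j) differentiable (at t)"
  by (rule matrix_inv_differentiable[OF open_V _ invertible_G differentiable_G])

lemma continuous_inv_entry: "continuous_on V (\<lambda>t. matrix_inv (G t) $ i $ j)"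
  by (auto intro!: continuous_at_imp_continuous_on differentiable_imp_continuous_within differentiable_inv)

lemma continuous_inv: "continuous_on V (\<lambda>t. matrix_inv (G t))"
proof -
  have "continuous_on V (\<lambda>t. \<chi> i j. matrix_inv (G t) $ i $ j)"
    by (intro continuous_on_vec_lambda continuous_inv_entry)
  then show ?thesis by simp
qed

lemma continuous_drift: "continuous_on V (metric_drift G)"
proof -
  have "continuous_on V (partial_deriv k (\<lambda>t. G t $ i $ j))" for i j k
    by (rule Ck_on_imp_continuous_on[OF Ck_on_partial_deriv[OF Ck_on_G[of "Suc 0"]]])
  then show ?thesis
    unfolding metric_drift_def[abs_def] christoffel_def
    by (intro continuous_on_vec_lambda continuous_on_minus continuous_on_sum continuous_on_mult
        continuous_on_add continuous_on_diff continuous_on_const continuous_inv_entry)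
qed

lemma inv_sym: "t \<in> V \<Longrightarrow> matrix_inv (G t) $ i $ j = matrix_inv (G t) $ j $ i"
  by (rule symmetric_entry, rule transpose_matrix_inv[OF invertible_G])
    (use pos_def positive_definite_def in blast)+

lemma pos_def_inv: "t \<in> V \<Longrightarrow> positive_definite (matrix_inv (G t))"
  using pos_def positive_definite_matrix_inv by blast

text \<open>The left side is the coefficient of the \<open>l\<close>-th partial derivative that the
  product rule leaves when the divergence of a gradient is expanded.\<close>

lemma drift_eq:
  assumes "t \<in> V"
  shows "(\<Sum>i\<in>UNIV. partial_deriv i (\<lambda>s. matrix_inv (G s) $ i $ l) t)
      + (\<Sum>i\<in>UNIV. \<Sum>j\<in>UNIV. christoffel G i i j t * matrix_inv (G t) $ j $ l) = metric_drift G t $ l"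
proof -
  have "partial_deriv k (\<lambda>s. G s $ i $ j) t = partial_deriv k (\<lambda>s. G s $ j $ i) t" for i j k
    by (intro partial_deriv_cong[OF open_V assms] symmetric_entry) (use pos_def positive_definite_def in blast)
  from christoffel_trace_identity[of "\<lambda>i j. matrix_inv (G t) $ i $ j" "\<lambda>k i j. partial_deriv k (\<lambda>s. G s $ i $ j) t"
      "\<lambda>l i j. christoffel G l i j t", OF inv_sym[OF assms] this christoffel_def]
  show ?thesis
    by (simp add: metric_drift_def partial_deriv_matrix_inv[OF open_V assms invertible_G differentiable_G[OF assms]])
qed

lemma tau_eq_laplacian:
  assumes "t \<in> V" "Ck_on 2 V u"
  shows "tau G u t = laplacian G u t"
proof -
  let ?a = "\<lambda>i j. complex_of_real (matrix_inv (G t) $ i $ j)"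
  let ?da = "\<lambda>i j. complex_of_real (partial_deriv i (\<lambda>s. matrix_inv (G s) $ i $ j) t)"
  let ?\<Gamma> = "\<lambda>i j. complex_of_real (christoffel G i i j t)"
  let ?D = "\<lambda>l. partial_deriv l u t"
  note dinv = differentiable_inv[OF assms(1)]
  have da: "(\<lambda>s. complex_of_real (matrix_inv (G s) $ i $ j)) differentiable (at t)" for i j
    by (rule has_derivative_imp_differentiable[OF has_derivative_of_real[OF frechet_derivative_has[OF dinv]]])
  have "partial_deriv i (\<lambda>s. gradient G u s $ i) t
      = (\<Sum>j\<in>UNIV. ?a i j * partial_deriv i (partial_deriv j u) t + ?da i j * ?D j)" for i
    unfolding gradient_def vec_lambda_beta
    by (subst partial_deriv_sum)
      (simp_all add: da Ck_on_2_D[OF assms(2,1)] partial_deriv_mult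
        partial_deriv_bounded_linear[OF bounded_linear_of_real dinv])
  then have "tau G u t = (\<Sum>i\<in>UNIV. \<Sum>j\<in>UNIV. ?a i j * partial_deriv i (partial_deriv j u) t)
      + ((\<Sum>i\<in>UNIV. \<Sum>l\<in>UNIV. ?da i l * ?D l)
        + (\<Sum>i\<in>UNIV. \<Sum>j\<in>UNIV. \<Sum>l\<in>UNIV. ?\<Gamma> i j * ?a j l * ?D l))"
    by (simp add: tau_def divergence_def gradient_def sum.distrib sum_distrib_left mult.assoc)
  also have "(\<Sum>i\<in>UNIV. \<Sum>l\<in>UNIV. ?da i l * ?D l) = (\<Sum>l\<in>UNIV. (\<Sum>i\<in>UNIV. ?da i l) * ?D l)"
    by (subst sum.swap) (simp add: sum_distrib_right)
  also have "(\<Sum>i\<in>UNIV. \<Sum>j\<in>UNIV. \<Sum>l\<in>UNIV. ?\<Gamma> i j * ?a j l * ?D l)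
      = (\<Sum>l\<in>UNIV. (\<Sum>i\<in>UNIV. \<Sum>j\<in>UNIV. ?\<Gamma> i j * ?a j l) * ?D l)"
    unfolding sum_distrib_right by (subst (2) sum.swap, subst sum.swap, rule refl)
  also have "(\<Sum>l\<in>UNIV. (\<Sum>i\<in>UNIV. ?da i l) * ?D l)
        + (\<Sum>l\<in>UNIV. (\<Sum>i\<in>UNIV. \<Sum>j\<in>UNIV. ?\<Gamma> i j * ?a j l) * ?D l)
      = (\<Sum>l\<in>UNIV. metric_drift G t $ l *\<^sub>R ?D l)"
    by (simp add: drift_eq[OF assms(1), symmetric] scaleR_conv_of_real distrib_right sum.distrib)
  finally show ?thesis by (simp add: elliptic_op_def scaleR_conv_of_real)
qed

text \<open>Of the two inverse metrics brought in by the gradients, one cancels against the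
  metric.\<close>

lemma kappa_eq_grad_prod:
  assumes "t \<in> V"
  shows "kappa G u v t = grad_prod (matrix_inv (G t)) u v t"
proof -
  let ?a = "matrix_inv (G t)"
  have "(\<Sum>j\<in>UNIV. complex_of_real (G t $ i $ j) * gradient G v t $ j) = partial_deriv i v t" for i
  proof -
    have "(\<Sum>j\<in>UNIV. complex_of_real (G t $ i $ j) * gradient G v t $ j)
      = (\<Sum>l\<in>UNIV. complex_of_real (\<Sum>j\<in>UNIV. G t $ i $ j * ?a $ j $ l) * partial_deriv l v t)"
      unfolding gradient_def vec_lambda_beta sum_distrib_left of_real_sum sum_distrib_right
      by (subst sum.swap) (simp add: mult.assoc)
    also have "\<dots> = (\<Sum>l\<in>UNIV. if l = i then partial_deriv l v t else 0)"
    proof (intro sum.cong refl)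
      fix l
      have "(\<Sum>j\<in>UNIV. G t $ i $ j * ?a $ j $ l) = (if i = l then 1 else 0)"
        using matrix_inv_mult(1)[OF invertible_G[OF assms]]
        by (simp add: vec_eq_iff matrix_matrix_mult_def mat_def)
      then show "complex_of_real (\<Sum>j\<in>UNIV. G t $ i $ j * ?a $ j $ l) * partial_deriv l v t
          = (if l = i then partial_deriv l v t else 0)" by simp
    qed
    finally show ?thesis by simp
  qed
  then have "kappa G u v t = (\<Sum>i\<in>UNIV. gradient G u t $ i * partial_deriv i v t)"
    unfolding kappa_def metric_complex_def
    by (intro sum.cong refl) (simp add: mult_ac flip: sum_distrib_left)
  also have "\<dots> = (\<Sum>i\<in>UNIV. \<Sum>k\<in>UNIV. complex_of_real (?a $ k $ i) * partial_deriv k u t * partial_deriv i v t)"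
    by (simp add: gradient_def sum_distrib_right inv_sym[OF assms])
  finally show ?thesis
    unfolding grad_prod_def by (subst sum.swap) (simp add: scaleR_conv_of_real mult.assoc)
qed

lemma inv_nonneg: "t \<in> V \<Longrightarrow> 0 \<le> v \<bullet> (matrix_inv (G t) *v v)"
  using pos_def_inv[of t] by (cases "v = 0") (auto simp: positive_definite_def less_imp_le)

text \<open>In terms of the real part \<open>P\<close> and the imaginary part \<open>Q\<close>, the
  equation for \<kappa> fixes the difference of the squared lengths of their gradients and their
  inner product, while subharmonicity asks for a lower bound on the sum of the squared lengths. The
  argument is uniform in the sign of \<open>A\<close>.\<close>

lemma norm_square_subharmonic:
  assumes "t \<in> V" "Ck_on 2 V \<phi>"
    and tau: "tau G \<phi> t = - of_real A * \<phi> t"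
    and kappa: "kappa G \<phi> \<phi> t = - of_real A * \<phi> t * \<phi> t"
  shows "0 \<le> laplacian G (\<lambda>s. (norm (\<phi> s))\<^sup>2) t"
proof -
  define P where "P s = Re (\<phi> s)" for s
  define Q where "Q s = Im (\<phi> s)" for s
  let ?a = "matrix_inv (G t)" and ?b = "metric_drift G t"
  have C: "Ck_on 2 V P" "Ck_on 2 V Q"
    unfolding P_def[abs_def] Q_def[abs_def]
    using Ck_on_bounded_linear[OF bounded_linear_Re open_V assms(2)]
      Ck_on_bounded_linear[OF bounded_linear_Im open_V assms(2)] by simp_all
  have L: "laplacian G \<phi> t = - of_real A * \<phi> t"
    using tau tau_eq_laplacian[OF assms(1,2)] by simp
  have LP: "laplacian G P t = - A * P t" and LQ: "laplacian G Q t = - A * Q t"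
    using elliptic_op_bounded_linear[OF bounded_linear_Re open_V assms(1,2), of ?a ?b]
      elliptic_op_bounded_linear[OF bounded_linear_Im open_V assms(1,2), of ?a ?b] L
    by (simp_all add: P_def[abs_def] Q_def[abs_def])
  have dP: "partial_deriv i P t = Re (partial_deriv i \<phi> t)"
    and dQ: "partial_deriv i Q t = Im (partial_deriv i \<phi> t)" for i
    unfolding P_def[abs_def] Q_def[abs_def]
    using partial_deriv_bounded_linear[OF bounded_linear_Re Ck_on_2_D(1)[OF assms(2,1)]]
      partial_deriv_bounded_linear[OF bounded_linear_Im Ck_on_2_D(1)[OF assms(2,1)]] by simp_all
  define p where "p = pgrad P t"
  define q where "q = pgrad Q t"
  define \<alpha> where "\<alpha> = p \<bullet> (?a *v p)"
  define \<beta> where "\<beta> = q \<bullet> (?a *v q)"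
  define \<gamma> where "\<gamma> = p \<bullet> (?a *v q)"
  have sym: "q \<bullet> (?a *v p) = \<gamma>"
    unfolding \<gamma>_def using pos_def_inv[OF assms(1)] symmetric_inner by (auto simp: positive_definite_def)
  have K: "grad_prod ?a \<phi> \<phi> t = - of_real A * \<phi> t * \<phi> t"
    using kappa kappa_eq_grad_prod[OF assms(1)] by simp
  have "Re (grad_prod ?a \<phi> \<phi> t) = \<alpha> - \<beta>"
    by (simp add: \<alpha>_def \<beta>_def p_def q_def grad_prod_def quadratic_form_sum pgrad_def dP dQ
        right_diff_distrib sum_subtractf)
  then have 1: "\<alpha> - \<beta> = - A * ((P t)\<^sup>2 - (Q t)\<^sup>2)"
    unfolding K by (simp add: P_def Q_def power2_eq_square algebra_simps)
  have "Im (grad_prod ?a \<phi> \<phi> t) = p \<bullet> (?a *v q) + q \<bullet> (?a *v p)"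
    by (simp add: p_def q_def grad_prod_def quadratic_form_sum pgrad_def dP dQ
        distrib_left sum.distrib)
  then have 2: "\<gamma> = - A * P t * Q t"
    unfolding K sym \<gamma>_def[symmetric] by (simp add: P_def Q_def algebra_simps)
  text \<open>The gradient of \<open>|\<phi>|\<^sup>2 / 2\<close> has nonnegative square length; given the value of \<open>\<kappa>(\<phi>, \<phi>)\<close>, this is
    \<open>|\<nabla>\<phi>|\<^sup>2 \<ge> A |\<phi>|\<^sup>2\<close>.\<close>
  have "0 \<le> (P t *\<^sub>R p + Q t *\<^sub>R q) \<bullet> (?a *v (P t *\<^sub>R p + Q t *\<^sub>R q))"
    by (rule inv_nonneg[OF assms(1)])
  also have "\<dots> = (P t)\<^sup>2 * \<alpha> + 2 * (P t * Q t) * \<gamma> + (Q t)\<^sup>2 * \<beta>"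
    by (simp add: matrix_vector_right_distrib matrix_vector_mult_scaleR inner_add_left inner_add_right
        sym \<alpha>_def \<beta>_def \<gamma>_def[symmetric] power2_eq_square algebra_simps)
  finally have 3: "0 \<le> (P t)\<^sup>2 * \<alpha> + 2 * (P t * Q t) * \<gamma> + (Q t)\<^sup>2 * \<beta>" .
  have 4: "0 \<le> \<alpha>" "0 \<le> \<beta>" unfolding \<alpha>_def \<beta>_def by (intro inv_nonneg assms(1))+
  define w where "w = (P t)\<^sup>2 + (Q t)\<^sup>2"
  have "A * w \<le> \<alpha> + \<beta>"
  proof (cases "w = 0")
    case False
    then have "w > 0" by (simp add: w_def order_less_le)
    have \<alpha>: "\<alpha> = \<beta> - A * ((P t)\<^sup>2 - (Q t)\<^sup>2)" using 1 by simp
    \<comment> \<open>After \<alpha> and \<gamma> are eliminated, both sides equal 2 w (\<beta> - A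
      P^2).\<close>
    have "w * (\<alpha> + \<beta> - A * w) = 2 * ((P t)\<^sup>2 * \<alpha> + 2 * (P t * Q t) * \<gamma> + (Q t)\<^sup>2 * \<beta>)"
      unfolding w_def 2 \<alpha> by (simp add: power2_eq_square algebra_simps)
    then have "0 \<le> w * (\<alpha> + \<beta> - A * w)" using 3 by simp
    then show ?thesis using \<open>w > 0\<close> by (simp add: zero_le_mult_iff)
  qed (use 4 in simp)
  moreover have "laplacian G (\<lambda>s. (norm (\<phi> s))\<^sup>2) t = 2 * (P t * laplacian G P t + \<alpha>) + 2 * (Q t * laplacian G Q t + \<beta>)"
  proof -
    have E1: "((\<lambda>x. x\<^sup>2) has_vector_derivative 2 * x) (at x)" for x :: real
      unfolding has_real_derivative_iff_has_vector_derivative[symmetric]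
      by (auto intro!: derivative_eq_intros)
    have E2: "((\<lambda>x. 2 * x) has_vector_derivative 2) (at x)" for x :: real
      unfolding has_real_derivative_iff_has_vector_derivative[symmetric]
      by (auto intro!: derivative_eq_intros)
    have sq: "Ck_on 2 V (\<lambda>s. (R s)\<^sup>2)" if "Ck_on 2 V R" for R :: "real^'n \<Rightarrow> real"
      unfolding power2_eq_square by (intro Ck_on_bilinear[OF bounded_bilinear_mult] open_V that)
    have "laplacian G (\<lambda>s. (norm (\<phi> s))\<^sup>2) t = laplacian G (\<lambda>s. (P s)\<^sup>2 + (Q s)\<^sup>2) t"
      by (simp add: cmod_power2 P_def Q_def)
    also have "\<dots> = laplacian G (\<lambda>s. (P s)\<^sup>2) t + laplacian G (\<lambda>s. (Q s)\<^sup>2) t"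
      by (intro elliptic_op_add[OF open_V assms(1)] sq C)
    finally show ?thesis
      using elliptic_op_compose[OF open_V assms(1) C(1) E1 E2, of ?a ?b]
        elliptic_op_compose[OF open_V assms(1) C(2) E1 E2, of ?a ?b]
      by (simp add: grad_prod_pgrad \<alpha>_def \<beta>_def p_def q_def)
  qed
  ultimately show ?thesis
    by (simp add: LP LQ w_def power2_eq_square algebra_simps)
qed

end

lemma (in chart_metric) chart_metric_subset:
  assumes "open U" "U \<subseteq> V"
  shows "chart_metric U G"
  using assms pos_def Ck_on_subset[OF Ck_on_G]
  by unfold_locales (auto simp: smooth_on_def)

section \<open>Functions of constant modulus expressed through their phases\<close>

lemma cis_has_vector_derivative: "(cis has_vector_derivative \<i> * cis x) (at x)"
  using has_derivative_cis[OF has_derivative_ident] by (simp add: has_vector_derivative_def)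

context chart_metric
begin

context
  fixes F :: "real^'n \<Rightarrow> real^'k::finite" and r :: "'k \<Rightarrow> real" and \<phi> :: "'k \<Rightarrow> real^'n \<Rightarrow> complex"
  assumes C2: "\<And>i. Ck_on 2 V (\<lambda>s. F s $ i)"
    and phase: "\<And>i s. s \<in> V \<Longrightarrow> \<phi> i s = of_real (r i) * cis (F s $ i)"
begin

lemma tau_phase:
  assumes "t \<in> V"
  shows "tau G (\<phi> i) t = \<phi> i t * (\<i> * of_real (laplacian G (\<lambda>s. F s $ i) t)
    - of_real (grad_prod (matrix_inv (G t)) (\<lambda>s. F s $ i) (\<lambda>s. F s $ i) t))"
proof -
  have E1: "((\<lambda>x. of_real (r i) * cis x) has_vector_derivative of_real (r i) * (\<i> * cis x)) (at x)" for x
    by (rule has_vector_derivative_mult_right[OF cis_has_vector_derivative])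
  have "((\<lambda>x. of_real (r i) * (\<i> * cis x)) has_vector_derivative of_real (r i) * (\<i> * (\<i> * cis x))) (at x)" for x
    by (intro has_vector_derivative_mult_right cis_has_vector_derivative)
  then have E2: "((\<lambda>x. of_real (r i) * (\<i> * cis x)) has_vector_derivative - (of_real (r i) * cis x)) (at x)" for x
    by (simp flip: mult.assoc)
  have "Ck_on 2 V (\<lambda>s. of_real (r i) * cis (F s $ i))"
    by (intro Ck_on_bounded_linear[OF bounded_linear_mult_right] Ck_on_cis open_V C2)
  then have "Ck_on 2 V (\<phi> i)"
    by (rule Ck_on_cong[OF open_V]) (simp add: phase)
  then have "tau G (\<phi> i) t = laplacian G (\<phi> i) t" by (rule tau_eq_laplacian[OF assms])
  also have "\<dots> = laplacian G (\<lambda>s. of_real (r i) * cis (F s $ i)) t"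
    by (rule elliptic_op_cong[OF open_V assms phase])
  also have "\<dots> = laplacian G (\<lambda>s. F s $ i) t *\<^sub>R (of_real (r i) * (\<i> * cis (F t $ i)))
      + grad_prod (matrix_inv (G t)) (\<lambda>s. F s $ i) (\<lambda>s. F s $ i) t *\<^sub>R (- (of_real (r i) * cis (F t $ i)))"
    by (rule elliptic_op_compose[OF open_V assms C2 E1 E2])
  finally show ?thesis by (simp add: phase[OF assms] scaleR_conv_of_real algebra_simps)
qed

lemma kappa_phase:
  assumes "t \<in> V"
  shows "kappa G (\<phi> i) (\<phi> j) t
    = - (\<phi> i t * \<phi> j t * of_real (grad_prod (matrix_inv (G t)) (\<lambda>s. F s $ i) (\<lambda>s. F s $ j) t))"
proof -
  have "partial_deriv l (\<phi> i) t = partial_deriv l (\<lambda>s. F s $ i) t *\<^sub>R (\<i> * \<phi> i t)" for i l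
  proof -
    have "partial_deriv l (\<phi> i) t = partial_deriv l (\<lambda>s. of_real (r i) * cis (F s $ i)) t"
      by (rule partial_deriv_cong[OF open_V assms phase])
    also have "\<dots> = partial_deriv l (\<lambda>s. F s $ i) t *\<^sub>R (of_real (r i) * (\<i> * cis (F t $ i)))"
      by (rule partial_deriv_compose[OF has_vector_derivative_mult_right[OF cis_has_vector_derivative]
            Ck_on_2_D(1)[OF C2 assms]])
    finally show ?thesis by (simp add: phase[OF assms] mult_ac)
  qed
  then show ?thesis
    by (simp add: kappa_eq_grad_prod[OF assms] grad_prod_def scaleR_conv_of_real sum_distrib_left
        sum_negf[symmetric] mult_ac)
qed

text \<open>Division by the nonvanishing functions turns the equation for \<tau> into a complex
  number identity: its imaginary part is harmonicity of the phase, its real part repeats the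
  diagonal case of the equation for \<kappa>. This is where the eigenvalues have to match the
  diagonal of \<open>A\<close>.\<close>

lemma phase_equations_iff:
  assumes "t \<in> V" "\<And>i. r i \<noteq> 0"
  shows "(\<forall>i. tau G (\<phi> i) t = - of_real (A $ i $ i) * \<phi> i t) \<and>
      (\<forall>i j. kappa G (\<phi> i) (\<phi> j) t = - of_real (A $ i $ j) * \<phi> i t * \<phi> j t)
    \<longleftrightarrow> (\<forall>i. laplacian G (\<lambda>s. F s $ i) t = 0) \<and>
      (\<forall>i j. grad_prod (matrix_inv (G t)) (\<lambda>s. F s $ i) (\<lambda>s. F s $ j) t = A $ i $ j)"
proof -
  have nz: "\<phi> i t \<noteq> 0" for i using phase[OF assms(1)] assms(2) by simp
  have "kappa G (\<phi> i) (\<phi> j) t = - of_real (A $ i $ j) * \<phi> i t * \<phi> j t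
      \<longleftrightarrow> grad_prod (matrix_inv (G t)) (\<lambda>s. F s $ i) (\<lambda>s. F s $ j) t = A $ i $ j" for i j
    unfolding kappa_phase[OF assms(1)] using nz by (auto simp: mult.commute)
  moreover have "tau G (\<phi> i) t = - of_real (A $ i $ i) * \<phi> i t
      \<longleftrightarrow> laplacian G (\<lambda>s. F s $ i) t = 0
        \<and> grad_prod (matrix_inv (G t)) (\<lambda>s. F s $ i) (\<lambda>s. F s $ i) t = A $ i $ i" for i
  proof -
    have "tau G (\<phi> i) t = - of_real (A $ i $ i) * \<phi> i t \<longleftrightarrow>
      \<i> * of_real (laplacian G (\<lambda>s. F s $ i) t)
        - of_real (grad_prod (matrix_inv (G t)) (\<lambda>s. F s $ i) (\<lambda>s. F s $ i) t) = - complex_of_real (A $ i $ i)"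
      unfolding tau_phase[OF assms(1)] using nz[of i] by (metis mult.commute mult_cancel_left)
    then show ?thesis by (auto simp: complex_eq_iff)
  qed
  ultimately show ?thesis by blast
qed

end

end

section \<open>Riemannian submersions in coordinates\<close>

lemma inner_transpose_mult:
  fixes D :: "real^'n^'k"
  shows "(transpose D *v \<xi>) \<bullet> w = \<xi> \<bullet> (D *v w)"
  by (metis dot_lmul_matrix transpose_matrix_vector)

declare transpose_matrix_vector [simp del]

lemma gram_matrix_quadratic:
  fixes D :: "real^'n^'k"
  shows "\<xi> \<bullet> ((D ** a ** transpose D) *v \<eta>) = (transpose D *v \<xi>) \<bullet> (a *v (transpose D *v \<eta>))"
  by (simp only: inner_transpose_mult matrix_vector_mul_assoc[symmetric])

text \<open>A vector annihilated by \<open>transpose D\<close> lies in the kernel of the whole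
  product, so invertibility upgrades the semidefiniteness of a Gram matrix to definiteness.\<close>

lemma gram_positive_definite:
  fixes D :: "real^'n^'k"
  assumes a: "positive_definite a" and inv: "invertible (D ** a ** transpose D)"
  shows "positive_definite (D ** a ** transpose D)"
  unfolding positive_definite_def
proof (intro conjI allI impI)
  show "transpose (D ** a ** transpose D) = D ** a ** transpose D"
    using a by (simp add: matrix_transpose_mul matrix_mul_assoc positive_definite_def)
  fix v :: "real^'k" assume "v \<noteq> 0"
  have "transpose D *v v \<noteq> 0"
  proof
    assume "transpose D *v v = 0"
    then have "(D ** a ** transpose D) *v v = 0"
      by (simp flip: matrix_vector_mul_assoc)
    then show False
      using inv \<open>v \<noteq> 0\<close> matrix_left_invertible_ker invertible_left_inverse by metis
  qed
  then show "v \<bullet> ((D ** a ** transpose D) *v v) > 0"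
    using a by (simp add: gram_matrix_quadratic positive_definite_def)
qed

text \<open>The vectors \<open>a *v (transpose D *v \<xi>)\<close>, with a = G^-1, are the
  horizontal lifts. \<open>D\<close> sends such a lift to \<open>P *v \<xi>\<close>, and the inner
  product of the lifts of \<xi> and \<eta> is \<open>\<xi> \<bullet> (P *v \<eta>)\<close>. Isometry
  on lifts thus reads P A^-1 P = P, and surjectivity of \<open>D\<close> allows \<open>P\<close> to
  be cancelled.\<close>

lemma horizontal_isometry_iff:
  fixes D :: "real^'n^'k" and G :: "real^'n^'n"
  assumes G: "positive_definite G" and A: "positive_definite A"
  defines "hor \<equiv> {u. \<forall>w. D *v w = 0 \<longrightarrow> u \<bullet> (G *v w) = 0}"
  shows "surj ((*v) D) \<and> (\<forall>u\<in>hor. \<forall>v\<in>hor. (D *v u) \<bullet> (matrix_inv A *v (D *v v)) = u \<bullet> (G *v v))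
    \<longleftrightarrow> D ** matrix_inv G ** transpose D = A"
proof -
  define a where "a = matrix_inv G"
  define P where "P = D ** a ** transpose D"
  have Ga: "G *v (a *v x) = x" and aG: "a *v (G *v x) = x" for x
    by (simp_all add: a_def matrix_vector_mul_assoc matrix_inv_mult positive_definite_invertible G)
  have AiA: "A *v (matrix_inv A *v x) = x" "matrix_inv A *v (A *v x) = x" for x
    by (simp_all add: matrix_vector_mul_assoc matrix_inv_mult positive_definite_invertible A)
  have symG: "x \<bullet> (G *v y) = y \<bullet> (G *v x)" for x y
    using G symmetric_inner by (auto simp: positive_definite_def)
  have a: "positive_definite a" unfolding a_def using G positive_definite_matrix_inv by blast
  have Px: "P *v \<xi> = D *v (a *v (transpose D *v \<xi>))" for \<xi>
    by (simp add: P_def flip: matrix_vector_mul_assoc)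
  have lift: "(a *v (transpose D *v \<xi>)) \<bullet> (G *v w) = \<xi> \<bullet> (D *v w)" for \<xi> w
    by (subst symG) (simp add: Ga inner_commute[of w] inner_transpose_mult)
  show ?thesis
  proof
    assume PA: "D ** matrix_inv G ** transpose D = A"
    then have P: "P = A" by (simp add: P_def a_def)
    have "D *v (a *v (transpose D *v (matrix_inv A *v y))) = y" for y
      using Px[of "matrix_inv A *v y"] by (simp add: P AiA)
    then have "surj ((*v) D)" by (rule surjI)
    moreover have "(D *v u) \<bullet> (matrix_inv A *v (D *v v)) = u \<bullet> (G *v v)" if "v \<in> hor" for u v
    proof -
      define \<eta> where "\<eta> = matrix_inv A *v (D *v v)"
      \<comment> \<open>The difference of a horizontal vector and the lift with the same image lies
        in the kernel of \<open>D\<close> and is orthogonal to that kernel, hence to itself.\<close>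
      define v' where "v' = v - a *v (transpose D *v \<eta>)"
      have "D *v v' = 0"
        by (simp add: v'_def matrix_vector_mult_diff_distrib Px[symmetric] P \<eta>_def AiA)
      moreover from this have "v \<bullet> (G *v v') = 0" using that by (simp add: hor_def)
      moreover have "v' \<bullet> (G *v v') = v \<bullet> (G *v v') - (a *v (transpose D *v \<eta>)) \<bullet> (G *v v')"
        by (subst (1) v'_def) (rule inner_diff_left)
      ultimately have "v' \<bullet> (G *v v') = 0" unfolding lift by simp
      then have "v' = 0" using G by (auto simp: positive_definite_def dest!: spec[of _ v'])
      then have "v = a *v (transpose D *v \<eta>)" by (simp add: v'_def)
      then have "u \<bullet> (G *v v) = u \<bullet> (transpose D *v \<eta>)" by (simp add: Ga)
      also have "\<dots> = \<eta> \<bullet> (D *v u)" by (simp add: inner_commute[of u] inner_transpose_mult)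
      finally show ?thesis by (simp add: \<eta>_def inner_commute)
    qed
    ultimately show "surj ((*v) D) \<and>
        (\<forall>u\<in>hor. \<forall>v\<in>hor. (D *v u) \<bullet> (matrix_inv A *v (D *v v)) = u \<bullet> (G *v v))" by blast
  next
    assume asm: "surj ((*v) D) \<and>
        (\<forall>u\<in>hor. \<forall>v\<in>hor. (D *v u) \<bullet> (matrix_inv A *v (D *v v)) = u \<bullet> (G *v v))"
    have hor: "a *v (transpose D *v \<xi>) \<in> hor" for \<xi> by (simp add: hor_def lift)
    have iso: "(P *v \<xi>) \<bullet> (matrix_inv A *v (P *v \<eta>)) = \<xi> \<bullet> (P *v \<eta>)" for \<xi> \<eta>
      using asm hor[of \<xi>] hor[of \<eta>] by (simp add: Px lift)
    have symP: "transpose P = P"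
      using a by (simp add: P_def matrix_transpose_mul matrix_mul_assoc positive_definite_def)
    \<comment> \<open>A kernel vector of \<open>P\<close> is killed by \<open>transpose D\<close>,
      so it is orthogonal to the range of \<open>D\<close>, which is everything.\<close>
    have "x = 0" if "P *v x = 0" for x
    proof -
      have "(transpose D *v x) \<bullet> (a *v (transpose D *v x)) = 0"
        using that by (simp flip: gram_matrix_quadratic P_def)
      then have "transpose D *v x = 0"
        using a by (auto simp: positive_definite_def dest!: spec[of _ "transpose D *v x"])
      then have "x \<bullet> (D *v w) = 0" for w using inner_transpose_mult[of D x w] by simp
      moreover obtain w where "D *v w = x" using asm by (metis surjD)
      ultimately show "x = 0" by (metis inner_eq_zero_iff)
    qed
    then have "\<exists>B. B ** P = mat 1" using matrix_left_invertible_ker by blast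
    then have invP: "invertible P" by (simp add: invertible_left_inverse)
    have "P *v \<eta> = A *v \<eta>" for \<eta>
    proof -
      \<comment> \<open>The defect is orthogonal to the range of the invertible matrix
        \<open>P\<close>, and therefore to itself.\<close>
      define z where "z = matrix_inv A *v (P *v \<eta>) - \<eta>"
      have "(P *v \<xi>) \<bullet> z = 0" for \<xi>
        using iso[of \<xi> \<eta>] symmetric_inner[OF symP, of \<xi> \<eta>]
        by (simp add: z_def inner_diff_right inner_commute)
      from this[of "matrix_inv P *v z"] have "z \<bullet> z = 0"
        by (simp add: matrix_vector_mul_assoc matrix_inv_mult invP)
      then have "matrix_inv A *v (P *v \<eta>) = \<eta>" by (simp add: z_def)
      then show ?thesis using AiA(1) by metis
    qed
    then have "P = A" by (simp add: matrix_eq)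
    then show "D ** matrix_inv G ** transpose D = A" by (simp add: P_def a_def)
  qed
qed

lemma gram_entry:
  fixes D :: "real^'n^'k"
  shows "(D ** a ** transpose D) $ i $ j = D $ i \<bullet> (a *v D $ j)"
proof -
  have "transpose D *v axis l 1 = D $ l" for l
    by (simp add: matrix_vector_mult_basis column_def transpose_def vec_eq_iff)
  then show ?thesis
    using gram_matrix_quadratic[of "axis i 1" D a "axis j 1"]
    by (simp add: inner_axis' matrix_vector_mult_basis column_def)
qed

lemma frechet_derivative_pgrad:
  fixes F :: "real^'n \<Rightarrow> real^'k"
  assumes "F differentiable (at t)"
  shows "frechet_derivative F (at t) = (*v) (\<chi> i. pgrad (\<lambda>s. F s $ i) t)"
proof
  fix v
  have "frechet_derivative F (at t) v $ i = pgrad (\<lambda>s. F s $ i) t \<bullet> v" for i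
  proof -
    have D: "((\<lambda>s. F s $ i) has_derivative (\<lambda>v. frechet_derivative F (at t) v $ i)) (at t)"
      by (rule bounded_linear.has_derivative[OF bounded_linear_vec_nth frechet_derivative_has[OF assms]])
    from frechet_derivative_eqI[OF D]
      frechet_derivative_eqI[OF has_derivative_partial[OF has_derivative_imp_differentiable[OF D]]]
    have "frechet_derivative F (at t) v $ i = (\<Sum>j\<in>UNIV. v $ j *\<^sub>R partial_deriv j (\<lambda>s. F s $ i) t)"
      by metis
    then show ?thesis by (simp add: pgrad_def inner_vec_def mult.commute)
  qed
  then show "frechet_derivative F (at t) v = (\<chi> i. pgrad (\<lambda>s. F s $ i) t) *v v"
    by (simp add: vec_eq_iff matrix_mult_dot)
qed

text \<open>Reducedness concerns a complex matrix. A real kernel vector of \<open>A\<close> is also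
  a complex one, and the real inverse, up to sign, is a complex inverse.\<close>

lemma invertible_complex_matrix_iff:
  fixes A :: "real^'k^'k"
  shows "invertible (\<chi> i j. - complex_of_real (A $ i $ j)) \<longleftrightarrow> invertible A"
    (is "invertible ?B \<longleftrightarrow> _")
proof
  assume B: "invertible ?B"
  have "x = 0" if "A *v x = 0" for x
  proof -
    have "(?B *v (\<chi> j. complex_of_real (x $ j))) $ i = - complex_of_real ((A *v x) $ i)" for i
      by (simp add: matrix_vector_mult_def sum_negf)
    then have "?B *v (\<chi> j. complex_of_real (x $ j)) = 0"
      using that by (simp add: vec_eq_iff)
    then have "(\<chi> j. complex_of_real (x $ j)) = 0"
      using B unfolding invertible_left_inverse matrix_left_invertible_ker by blast
    then show "x = 0" by (simp add: vec_eq_iff)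
  qed
  then show "invertible A" by (simp add: invertible_left_inverse matrix_left_invertible_ker)
next
  assume A: "invertible A"
  have "(\<chi> i j. - complex_of_real (matrix_inv A $ i $ j)) ** ?B = mat 1"
  proof -
    have "((\<chi> i j. - complex_of_real (matrix_inv A $ i $ j)) ** ?B) $ i $ j
        = complex_of_real ((matrix_inv A ** A) $ i $ j)" for i j
      by (simp add: matrix_matrix_mult_def)
    then show ?thesis by (simp add: vec_eq_iff matrix_inv_mult A mat_def)
  qed
  then show "invertible ?B" unfolding invertible_left_inverse by blast
qed

section \<open>Angular coordinates on the torus\<close>

text \<open>Near \<open>t\<close> the quotient of \<psi>(s) by \<psi>(t), written with a conjugate
  because the moduli are 1, is close to 1, so its principal logarithm gives small angle increments.
  Added to the angles at \<open>t\<close> they stay in the open set \<open>W\<close>, and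
  injectivity on \<open>W\<close> identifies them with the inverse branch. As \<open>W\<close> may
  have any shape, the formula is only local.\<close>

lemma angular_lift:
  fixes \<psi> :: "'a::real_normed_vector \<Rightarrow> complex^'k"
  assumes V: "open V" "t \<in> V" and unit: "\<And>s i. s \<in> V \<Longrightarrow> norm (\<psi> s $ i) = 1"
    and cont: "\<And>i. isCont (\<lambda>s. \<psi> s $ i) t"
    and W: "open W" "inj_on angular W" "\<psi> t \<in> angular ` W"
  shows "\<forall>\<^sub>F s in nhds t. \<psi> s \<in> angular ` W \<and> inv_into W angular (\<psi> s)
    = inv_into W angular (\<psi> t) + (\<chi> i. Im (Ln (\<psi> s $ i * cnj (\<psi> t $ i))))"
proof -
  define y where "y = inv_into W angular (\<psi> t)"
  define \<Theta> where "\<Theta> s = y + (\<chi> i. Im (Ln (\<psi> s $ i * cnj (\<psi> t $ i))))" for s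
  have y: "y \<in> W" "angular y = \<psi> t"
    using W(3) by (auto simp: y_def inv_into_into f_inv_into_f)
  have one: "\<psi> t $ i * cnj (\<psi> t $ i) = 1" for i
    using unit[OF V(2), of i] by (simp add: complex_norm_square[symmetric])
  have ang: "angular (\<Theta> s) = \<psi> s" if "s \<in> V" for s
  proof -
    have "cis (\<Theta> s $ i) = \<psi> s $ i" for i
    proof -
      define z where "z = \<psi> s $ i * cnj (\<psi> t $ i)"
      have z: "norm z = 1" using unit[OF that] unit[OF V(2)] by (simp add: z_def norm_mult)
      then have "z \<noteq> 0" by auto
      then have "z = exp (Ln z)" by simp
      also have "\<dots> = cis (Im (Ln z))" using z \<open>z \<noteq> 0\<close> by (simp add: exp_eq_polar)
      finally have "cis (Im (Ln z)) = z" by simp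
      then have "cis (\<Theta> s $ i) = \<psi> t $ i * z"
        using y(2) by (simp add: \<Theta>_def z_def angular_def vec_eq_iff flip: cis_mult)
      then show ?thesis using one[of i] by (simp add: z_def mult_ac)
    qed
    then show ?thesis by (simp add: angular_def vec_eq_iff)
  qed
  have lim: "((\<lambda>s. Im (Ln (\<psi> s $ i * cnj (\<psi> t $ i)))) \<longlongrightarrow> Im (Ln 1)) (nhds t)" for i
  proof -
    have "((\<lambda>s. \<psi> s $ i) \<longlongrightarrow> \<psi> t $ i) (nhds t)"
      using cont[of i] tendsto_at_iff_tendsto_nhds[of "\<lambda>s. \<psi> s $ i" t] by (simp add: isCont_def)
    then have "((\<lambda>s. \<psi> s $ i * cnj (\<psi> t $ i)) \<longlongrightarrow> 1) (nhds t)"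
      using tendsto_mult[OF _ tendsto_const, of "\<lambda>s. \<psi> s $ i" "\<psi> t $ i" "nhds t" "cnj (\<psi> t $ i)"]
      by (simp only: one)
    then show ?thesis
      by (intro tendsto_Im tendsto_Ln) auto
  qed
  have "(\<Theta> \<longlongrightarrow> y + (\<chi> i. Im (Ln 1))) (nhds t)"
    unfolding \<Theta>_def[abs_def] by (intro tendsto_add tendsto_const tendsto_vec_lambda lim)
  moreover have "y + (\<chi> i. Im (Ln 1)) = y" by (simp add: vec_eq_iff)
  ultimately have "\<forall>\<^sub>F s in nhds t. \<Theta> s \<in> W"
    using W(1) y(1) topological_tendstoD by fastforce
  moreover have "\<forall>\<^sub>F s in nhds t. s \<in> V" using V by (rule eventually_nhds_in_open)
  ultimately show ?thesis
  proof eventually_elim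
    case (elim s)
    then have "inv_into W angular (\<psi> s) = \<Theta> s"
      using ang[of s] W(2) by (metis inv_into_f_eq)
    then show ?case using ang[of s] elim by (force simp: \<Theta>_def y_def)
  qed
qed

text \<open>The logarithm in the local formula is differentiated at the argument 1, away from its
  branch cut.\<close>

lemma angular_lift_differentiable:
  fixes \<psi> :: "'a::real_normed_vector \<Rightarrow> complex^'k"
  assumes V: "open V" "t \<in> V" and unit: "\<And>s i. s \<in> V \<Longrightarrow> norm (\<psi> s $ i) = 1"
    and diff: "\<And>i. (\<lambda>s. \<psi> s $ i) differentiable (at t)"
    and W: "open W" "inj_on angular W" "\<psi> t \<in> angular ` W"
  shows "(\<lambda>s. inv_into W angular (\<psi> s) $ i) differentiable (at t)"
proof -
  have "isCont (\<lambda>s. \<psi> s $ i) t" for i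
    using diff differentiable_imp_continuous_within by blast
  from angular_lift[OF V unit this W] obtain U where U: "open U" "t \<in> U"
    "\<And>s. s \<in> U \<Longrightarrow> inv_into W angular (\<psi> s) = inv_into W angular (\<psi> t) + (\<chi> i. Im (Ln (\<psi> s $ i * cnj (\<psi> t $ i))))"
    unfolding eventually_nhds by blast
  have one: "\<psi> t $ i * cnj (\<psi> t $ i) = 1" for i
    using unit[OF V(2), of i] by (simp add: complex_norm_square[symmetric])
  obtain D where "((\<lambda>s. \<psi> s $ i) has_derivative D) (at t)"
    using diff by (auto simp: differentiable_def)
  then have "((\<lambda>s. \<psi> s $ i * cnj (\<psi> t $ i)) has_derivative (\<lambda>v. D v * cnj (\<psi> t $ i))) (at t)"
    by (rule has_derivative_mult_left)
  moreover have "(Ln has_derivative (*) 1) (at (\<psi> t $ i * cnj (\<psi> t $ i)))"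
    using has_field_derivative_Ln[of 1] unfolding one by (simp add: has_field_derivative_def)
  ultimately have "((\<lambda>s. Ln (\<psi> s $ i * cnj (\<psi> t $ i))) has_derivative (\<lambda>v. 1 * (D v * cnj (\<psi> t $ i)))) (at t)"
    by (rule has_derivative_compose)
  then have "((\<lambda>s. inv_into W angular (\<psi> t) $ i + Im (Ln (\<psi> s $ i * cnj (\<psi> t $ i))))
      has_derivative (\<lambda>v. 0 + Im (1 * (D v * cnj (\<psi> t $ i))))) (at t)"
    by (intro has_derivative_add has_derivative_const has_derivative_Im)
  then have "((\<lambda>s. inv_into W angular (\<psi> s) $ i) has_derivative (\<lambda>v. 0 + Im (1 * (D v * cnj (\<psi> t $ i))))) (at t)"
    by (rule has_derivative_transform_within_open[OF _ U(1,2)]) (simp add: U(3))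
  then show ?thesis by (rule has_derivative_imp_differentiable)
qed

text \<open>Coordinates of two points of the ball differ by less than a full period. These balls
  supply the charts around arbitrary points of the torus.\<close>

lemma angular_inj_on_ball: "inj_on angular (ball y pi)"
proof (rule inj_onI)
  fix u v assume uv: "u \<in> ball y pi" "v \<in> ball y pi" "angular u = angular v"
  have "u $ i = v $ i" for i
  proof -
    have "\<bar>(u - y) $ i\<bar> < pi" "\<bar>(v - y) $ i\<bar> < pi"
      using component_le_norm_cart[of "u - y" i] component_le_norm_cart[of "v - y" i] uv(1,2)
      by (auto simp: dist_norm norm_minus_commute)
    then have "\<bar>u $ i - v $ i\<bar> < 2 * pi" by (simp add: abs_if split: if_splits)
    moreover have "cis (u $ i) = cis (v $ i)"
      using uv(3) by (simp add: angular_def vec_eq_iff)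
    then have "exp (\<i> * of_real (u $ i)) = exp (\<i> * of_real (v $ i))" by (simp add: cis_conv_exp)
    ultimately show ?thesis
      using exp_complex_eqI[of "\<i> * of_real (u $ i)" "\<i> * of_real (v $ i)"] by simp
  qed
  then show "u = v" by (simp add: vec_eq_iff)
qed

section \<open>Functions on Riemannian manifolds\<close>

lemma riemannian_manifold_chartD:
  assumes "riemannian_manifold M" "(V, p) \<in> charts M"
  shows "open V" "openin (top_of_set (points M)) (p ` V)"
    "homeomorphism V (p ` V) p (inv_into V p)" "chart_metric V (riem_metric M (V, p))"
    "p ` V \<subseteq> points M"
proof -
  show 1: "open V" "openin (top_of_set (points M)) (p ` V)" "homeomorphism V (p ` V) p (inv_into V p)"
    using assms unfolding riemannian_manifold_def by blast+
  show "p ` V \<subseteq> points M" using 1(2) openin_imp_subset by blast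
  have "\<forall>c \<in> charts M. (\<forall>i j. smooth_on (fst c) (\<lambda>t. riem_metric M c t $ i $ j)) \<and>
        (\<forall>t \<in> fst c. positive_definite (riem_metric M c t))"
    using assms(1) unfolding riemannian_manifold_def by blast
  then show "chart_metric V (riem_metric M (V, p))"
    using assms(2) 1(1) by unfold_locales force+
qed

lemma riemannian_manifold_point:
  assumes "riemannian_manifold M" "x \<in> points M"
  obtains V p t where "(V, p) \<in> charts M" "t \<in> V" "x = p t"
proof -
  have "points M = (\<Union>(V, p) \<in> charts M. p ` V)"
    using assms(1) unfolding riemannian_manifold_def by blast
  then show ?thesis using assms(2) that by blast
qed

lemma smooth_fun_continuous_on:
  assumes "riemannian_manifold M" "smooth_fun M f"
  shows "continuous_on (points M) f"
  unfolding continuous_on_eq_continuous_within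
proof
  fix x assume "x \<in> points M"
  then obtain V p t where c: "(V, p) \<in> charts M" "t \<in> V" "x = p t"
    using riemannian_manifold_point assms(1) by metis
  note chart = riemannian_manifold_chartD[OF assms(1) c(1)]
  have "Ck_on r V (f \<circ> p)" for r using assms(2) c(1) by (auto simp: smooth_fun_def smooth_on_def)
  then have "continuous_on (p ` V) ((f \<circ> p) \<circ> inv_into V p)"
    using chart(3) homeomorphism_cont2 homeomorphism_image2
    by (metis Ck_on.simps(1) continuous_on_compose)
  moreover have "((f \<circ> p) \<circ> inv_into V p) y = f y" if "y \<in> p ` V" for y
    using that by (simp add: f_inv_into_f)
  ultimately have "continuous_on (p ` V) f"
    using continuous_on_cong by force
  then have "continuous (at x within p ` V) f"
    using c by (simp add: continuous_on_eq_continuous_within)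
  moreover obtain O' where "open O'" "p ` V = points M \<inter> O'"
    using chart(2) by (auto simp: openin_open)
  then have "at x within p ` V = at x within points M"
    using c by (intro at_within_nhd[of x O']) auto
  ultimately show "continuous (at x within points M) f" by simp
qed

text \<open>The maximum principle acts in one chart only. It becomes global because the maximum is
  attained by compactness and the set \<open>S\<close> of maximum points is closed by continuity and
  open by transport of coordinate balls; connectedness then leaves no other points.\<close>

lemma eigenfamily_norm_constant:
  assumes M: "riemannian_manifold M" "compact (points M)" "connected (points M)"
    and eig: "eigenfamily M (\<chi> i. - of_real (A $ i $ i)) (\<chi> i j. - of_real (A $ i $ j)) \<phi>"
    and "x \<in> points M" "y \<in> points M"
  shows "norm (\<phi> i x) = norm (\<phi> i y)"
proof -
  define w where "w z = (norm (\<phi> i z))\<^sup>2" for z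
  have smooth: "smooth_fun M (\<phi> i)" using eig by (simp add: eigenfamily_def)
  have wcont: "continuous_on (points M) w"
    unfolding w_def[abs_def] by (intro continuous_intros smooth_fun_continuous_on M smooth)
  obtain z0 where z0: "z0 \<in> points M" "\<And>z. z \<in> points M \<Longrightarrow> w z \<le> w z0"
    using continuous_attains_sup[OF M(2) _ wcont] \<open>x \<in> points M\<close> by auto
  define S where "S = {z \<in> points M. w z = w z0}"
  have "closedin (top_of_set (points M)) S"
    unfolding S_def by (rule continuous_closedin_preimage_constant[OF wcont])
  moreover have "openin (top_of_set (points M)) S"
    unfolding openin_subopen[of _ S]
  proof
    fix z assume "z \<in> S"
    then have "z \<in> points M" "w z = w z0" by (auto simp: S_def)
    then obtain V p t where c: "(V, p) \<in> charts M" "t \<in> V" "z = p t"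
      using riemannian_manifold_point M(1) by metis
    note chart = riemannian_manifold_chartD[OF M(1) c(1)]
    interpret chart_metric V "riem_metric M (V, p)" by (rule chart(4))
    have C2: "Ck_on 2 V (\<phi> i \<circ> p)" using smooth c(1) by (auto simp: smooth_fun_def smooth_on_def)
    have "\<exists>r>0. ball t r \<subseteq> V \<and> (\<forall>s\<in>ball t r. (norm ((\<phi> i \<circ> p) s))\<^sup>2 = w z0)"
    proof (rule strong_maximum_principle[OF open_V _ pos_def_inv continuous_inv continuous_drift])
      have "Ck_on 2 V (\<lambda>s. (\<phi> i \<circ> p) s \<bullet> (\<phi> i \<circ> p) s)"
        by (intro Ck_on_bilinear[OF bounded_bilinear_inner] open_V C2)
      then show "Ck_on 2 V (\<lambda>s. (norm ((\<phi> i \<circ> p) s))\<^sup>2)" by (simp only: dot_square_norm)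
      show "0 \<le> laplacian (riem_metric M (V, p)) (\<lambda>s. (norm ((\<phi> i \<circ> p) s))\<^sup>2) s" if "s \<in> V" for s
        by (rule norm_square_subharmonic[where A = "A $ i $ i", OF that C2])
          (use eig c(1) that in \<open>auto simp: eigenfamily_def\<close>)
      show "(norm ((\<phi> i \<circ> p) s))\<^sup>2 \<le> w z0" if "s \<in> V" for s
        using z0(2)[of "p s"] that chart(5) by (auto simp: w_def)
      show "t \<in> V" "(norm ((\<phi> i \<circ> p) t))\<^sup>2 = w z0"
        using c \<open>w z = w z0\<close> by (auto simp: w_def)
    qed
    then obtain r where r: "r > 0" "ball t r \<subseteq> V" "\<And>s. s \<in> ball t r \<Longrightarrow> w (p s) = w z0"
      by (auto simp: w_def)
    have "openin (top_of_set V) (ball t r)" using r(2) by (intro open_subset) auto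
    then have "openin (top_of_set (p ` V)) (p ` ball t r)"
      using homeomorphism_imp_open_map[OF chart(3)] by blast
    then have "openin (top_of_set (points M)) (p ` ball t r)"
      using chart(2) openin_trans by blast
    moreover have "z \<in> p ` ball t r" using c r(1) by simp
    moreover have "p ` ball t r \<subseteq> S" using r chart(5) by (auto simp: S_def)
    ultimately show "\<exists>T. openin (top_of_set (points M)) T \<and> z \<in> T \<and> T \<subseteq> S" by blast
  qed
  moreover have "z0 \<in> S" using z0(1) by (simp add: S_def)
  ultimately have "S = points M" using M(3) unfolding connected_clopen by blast
  then have "x \<in> S" "y \<in> S" using assms(5,6) by simp_all
  then have "w x = w y" by (simp add: S_def)
  then show ?thesis by (simp add: w_def)
qed

section \<open>The torus map\<close>

text \<open>The common ground of both implications. Only continuity of the functions is included: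
  when the torus map is given, their smoothness is a conclusion.\<close>

locale torus_setting =
  fixes M :: "('m::{t2_space,second_countable_topology}, 'n::finite) riem"
    and \<phi> :: "'k::finite \<Rightarrow> 'm \<Rightarrow> complex" and x0 :: 'm
  assumes manifold: "riemannian_manifold M"
    and nonzero: "\<And>i. \<phi> i x0 \<noteq> 0"
    and norm_eq: "\<And>i x. x \<in> points M \<Longrightarrow> norm (\<phi> i x) = norm (\<phi> i x0)"
    and cont: "\<And>i. continuous_on (points M) (\<phi> i)"
begin

abbreviation "\<pi> \<equiv> torus_map \<phi> x0"

abbreviation "ldom V p W \<equiv> local_dom \<pi> (V, p) (W, angular :: real^'k \<Rightarrow> complex^'k)"

abbreviation "lrep V p W \<equiv> local_rep \<pi> (V, p) (W, angular :: real^'k \<Rightarrow> complex^'k)"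

lemma torus_map_unit: "x \<in> points M \<Longrightarrow> norm (\<pi> x $ i) = 1"
  using norm_eq nonzero by (simp add: torus_map_def norm_divide)

lemma torus_map_continuous: "continuous_on (points M) \<pi>"
  unfolding torus_map_def by (intro continuous_on_vec_lambda continuous_intros cont) (simp add: nonzero)

context
  fixes V :: "(real^'n) set" and p :: "real^'n \<Rightarrow> 'm" and W :: "(real^'k) set"
  assumes chart: "(V, p) \<in> charts M" and W: "open W" "inj_on angular W"
begin

lemma open_dom: "open (ldom V p W)"
proof (subst open_subopen, intro ballI)
  note c = riemannian_manifold_chartD[OF manifold chart]
  fix t assume t: "t \<in> ldom V p W"
  then have tV: "t \<in> V" "\<pi> (p t) \<in> angular ` W" by (auto simp: local_dom_def)
  have "continuous_on V (\<lambda>s. \<pi> (p s))"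
    using continuous_on_compose2[OF torus_map_continuous homeomorphism_cont1[OF c(3)] c(5)] .
  then have isCont: "isCont (\<lambda>s. \<pi> (p s) $ i) t" for i
    using tV(1) c(1) by (intro continuous_intros) (simp add: continuous_on_eq_continuous_at)
  have unit: "norm (\<pi> (p s) $ i) = 1" if "s \<in> V" for s i
    using torus_map_unit c(5) that by blast
  have "\<forall>\<^sub>F s in nhds t. \<pi> (p s) \<in> angular ` W \<and> inv_into W angular (\<pi> (p s))
      = inv_into W angular (\<pi> (p t)) + (\<chi> i. Im (Ln (\<pi> (p s) $ i * cnj (\<pi> (p t) $ i))))"
    by (rule angular_lift[where \<psi> = "\<lambda>s. \<pi> (p s)", OF c(1) tV(1) _ _ W tV(2)]) (simp_all add: unit isCont)
  then have "\<forall>\<^sub>F s in nhds t. \<pi> (p s) \<in> angular ` W"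
    by (rule eventually_mono) (rule conjunct1)
  then have "\<forall>\<^sub>F s in nhds t. s \<in> ldom V p W"
    using eventually_nhds_in_open[OF c(1) tV(1)]
    by eventually_elim (simp add: local_dom_def)
  then show "\<exists>T. open T \<and> t \<in> T \<and> T \<subseteq> ldom V p W" by (auto simp: eventually_nhds)
qed

lemma angular_rep:
  assumes "t \<in> ldom V p W"
  shows "angular (lrep V p W t) = \<pi> (p t)"
  using assms by (simp add: local_dom_def local_rep_def f_inv_into_f)

lemma phase_rep:
  assumes "t \<in> ldom V p W"
  shows "(\<phi> i \<circ> p) t = of_real (norm (\<phi> i x0)) * cis (lrep V p W t $ i)"
  using arg_cong[OF angular_rep[OF assms], of "\<lambda>z. z $ i"] nonzero[of i]
  by (simp add: angular_def torus_map_def field_simps)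

lemma Ck_on_rep:
  assumes smooth: "\<And>i. smooth_fun M (\<phi> i)"
  shows "Ck_on r (ldom V p W) (\<lambda>s. lrep V p W s $ i)"
proof (rule Ck_on_angle[OF open_dom])
  note c = riemannian_manifold_chartD[OF manifold chart]
  have C: "Ck_on r V (\<phi> i \<circ> p)" for r i
    using smooth[of i] chart by (auto simp: smooth_fun_def smooth_on_def)
  have sub: "ldom V p W \<subseteq> V" by (auto simp: local_dom_def)
  have "Ck_on r (ldom V p W) (\<lambda>s. (1 / of_real (norm (\<phi> i x0))) * (\<phi> i \<circ> p) s)"
    by (rule Ck_on_bounded_linear[OF bounded_linear_mult_right open_dom Ck_on_subset[OF C sub]])
  then show "Ck_on r (ldom V p W) (\<lambda>s. cis (lrep V p W s $ i))"
    by (rule Ck_on_cong[OF open_dom]) (simp only: phase_rep, simp add: nonzero)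
  fix t assume t: "t \<in> ldom V p W"
  then have tV: "t \<in> V" "\<pi> (p t) \<in> angular ` W" by (auto simp: local_dom_def)
  have "(\<lambda>s. inv_into W angular (\<pi> (p s)) $ i) differentiable (at t)"
  proof (rule angular_lift_differentiable[where \<psi> = "\<lambda>s. \<pi> (p s)", OF c(1) tV(1) _ _ W tV(2)])
    show "norm (\<pi> (p s) $ j) = 1" if "s \<in> V" for s j
      using torus_map_unit c(5) that by blast
    show "(\<lambda>s. \<pi> (p s) $ j) differentiable (at t)" for j
    proof -
      have "(\<lambda>s. (1 / of_real (norm (\<phi> j x0))) * (\<phi> j \<circ> p) s) differentiable (at t)"
        by (rule Ck_on_imp_differentiable[OF Ck_on_bounded_linear[OF bounded_linear_mult_right c(1)
              C[of "Suc 0" j]] tV(1)])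
      moreover have "(\<lambda>s. \<pi> (p s) $ j) = (\<lambda>s. (1 / of_real (norm (\<phi> j x0))) * (\<phi> j \<circ> p) s)"
        by (simp add: torus_map_def)
      ultimately show ?thesis by (simp only:)
    qed
  qed
  then show "(\<lambda>s. lrep V p W s $ i) differentiable (at t)" by (simp add: local_rep_def)
qed

context
  fixes A :: "real^'k^'k" and t :: "real^'n"
  assumes C2: "\<And>i. Ck_on 2 (ldom V p W) (\<lambda>s. lrep V p W s $ i)"
    and t: "t \<in> ldom V p W"
begin

abbreviation "gmet \<equiv> riem_metric M (V, p)"

abbreviation "gram i j \<equiv> grad_prod (matrix_inv (gmet t)) (\<lambda>s. lrep V p W s $ i) (\<lambda>s. lrep V p W s $ j) t"

lemma eigen_equations_iff:
  "(\<forall>i. tau gmet (\<phi> i \<circ> p) t = - of_real (A $ i $ i) * (\<phi> i \<circ> p) t) \<and>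
   (\<forall>i j. kappa gmet (\<phi> i \<circ> p) (\<phi> j \<circ> p) t = - of_real (A $ i $ j) * (\<phi> i \<circ> p) t * (\<phi> j \<circ> p) t)
   \<longleftrightarrow> (\<forall>i. laplacian gmet (\<lambda>s. lrep V p W s $ i) t = 0) \<and> (\<forall>i j. gram i j = A $ i $ j)"
proof -
  note c = riemannian_manifold_chartD[OF manifold chart]
  have "chart_metric (ldom V p W) gmet"
    by (rule chart_metric.chart_metric_subset[OF c(4) open_dom]) (auto simp: local_dom_def)
  from chart_metric.phase_equations_iff[where \<phi> = "\<lambda>i. \<phi> i \<circ> p" and r = "\<lambda>i. norm (\<phi> i x0)",
      OF this C2 phase_rep t, of A]
  show ?thesis using nonzero by simp
qed

lemma tension_zero_iff:
  "tension gmet (riem_metric (flat_torus H) (W, angular)) (lrep V p W) t = 0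
    \<longleftrightarrow> (\<forall>i. laplacian gmet (\<lambda>s. lrep V p W s $ i) t = 0)"
  by (simp add: vec_eq_iff tension_flat_target flat_torus_def)

lemma gram_matrix:
  "((\<chi> i. pgrad (\<lambda>s. lrep V p W s $ i) t) ** matrix_inv (gmet t)
    ** transpose (\<chi> i. pgrad (\<lambda>s. lrep V p W s $ i) t)) $ i $ j = gram i j"
  by (simp add: gram_entry grad_prod_pgrad)

lemma submersion_iff:
  assumes "positive_definite A"
  shows "(let D = frechet_derivative (lrep V p W) (at t);
            G = gmet t;
            H = riem_metric (flat_torus (matrix_inv A)) (W, angular) (lrep V p W t);
            horizontal = {u. \<forall>w. D w = 0 \<longrightarrow> u \<bullet> (G *v w) = 0}
        in surj D \<and> (\<forall>u \<in> horizontal. \<forall>v \<in> horizontal. D u \<bullet> (H *v D v) = u \<bullet> (G *v v)))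
    \<longleftrightarrow> (\<forall>i j. gram i j = A $ i $ j)"
proof -
  have "Ck_on (Suc (Suc 0)) (ldom V p W) (lrep V p W)"
    by (rule Ck_on_vec[OF open_dom]) (use C2 numeral_2_eq_2 in metis)
  then have "lrep V p W differentiable (at t)" by (rule Ck_on_imp_differentiable[OF _ t])
  note D = frechet_derivative_pgrad[OF this]
  have G: "positive_definite (gmet t)"
    using chart_metric.pos_def[OF riemannian_manifold_chartD(4)[OF manifold chart]] t
    by (simp add: local_dom_def)
  have H: "riem_metric (flat_torus (matrix_inv A)) (W, angular) z = matrix_inv A" for z
    by (simp add: flat_torus_def)
  show ?thesis
    unfolding D H Let_def horizontal_isometry_iff[OF G assms]
    by (simp add: vec_eq_iff gram_matrix)
qed

lemma gram_positive_definite_inv: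
  assumes "\<And>i j. gram i j = A $ i $ j" "invertible A"
  shows "positive_definite A"
proof -
  let ?D = "\<chi> i. pgrad (\<lambda>s. lrep V p W s $ i) t"
  have A: "?D ** matrix_inv (gmet t) ** transpose ?D = A"
    by (simp add: vec_eq_iff gram_matrix assms(1))
  have "positive_definite (matrix_inv (gmet t))"
    using chart_metric.pos_def_inv[OF riemannian_manifold_chartD(4)[OF manifold chart]] t
    by (simp add: local_dom_def)
  from gram_positive_definite[OF this, of ?D] show ?thesis using assms(2) unfolding A by blast
qed

end

end

section \<open>Smoothness of the family and of the torus map\<close>

lemma torus_chart_around:
  assumes "x \<in> points M"
  obtains W where "open W" "inj_on angular W" "\<pi> x \<in> angular ` W"
proof -
  define y where "y = (\<chi> i. Arg (\<pi> x $ i))"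
  have "cis (Arg (\<pi> x $ i)) = \<pi> x $ i" for i
  proof -
    have "\<pi> x $ i \<noteq> 0" using torus_map_unit[OF assms, of i] by auto
    then show ?thesis using torus_map_unit[OF assms, of i] by (simp add: cis_Arg sgn_eq)
  qed
  then have "angular y = \<pi> x" by (simp add: y_def angular_def vec_eq_iff)
  then have "\<pi> x \<in> angular ` ball y pi" by (metis centre_in_ball image_eqI pi_gt_zero)
  then show ?thesis using that angular_inj_on_ball open_ball by blast
qed

lemma charts_flat_torus: "d \<in> charts (flat_torus H) \<longleftrightarrow> (\<exists>W. d = (W, angular) \<and> open W \<and> inj_on angular W)"
  by (cases d) (auto simp: flat_torus_def)

lemma torus_map_range: "\<pi> ` points M \<subseteq> points (flat_torus H)"
  using torus_map_unit by (auto simp: flat_torus_def)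

lemma smooth_map_torus:
  assumes "\<And>i. smooth_fun M (\<phi> i)"
  shows "smooth_map M (flat_torus H) \<pi>"
  unfolding smooth_map_def
proof (intro conjI ballI torus_map_range torus_map_continuous)
  fix c d assume c: "c \<in> charts M" and d: "d \<in> charts (flat_torus H)"
  obtain V p where "c = (V, p)" by (cases c)
  moreover obtain W where "d = (W, angular)" "open W" "inj_on angular W"
    using d charts_flat_torus by blast
  ultimately show "smooth_on (local_dom \<pi> c d) (local_rep \<pi> c d)"
    unfolding smooth_on_def using c by (auto intro!: Ck_on_vec open_dom Ck_on_rep assms)
qed

text \<open>On the domain of each angular chart the function is a constant modulus times
  \<open>cis\<close> of a smooth coordinate, and these domains cover the chart of
  \<open>M\<close>.\<close>

lemma smooth_fun_of_torus_map:
  assumes "smooth_map M (flat_torus H) \<pi>"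
  shows "smooth_fun M (\<phi> i)"
  unfolding smooth_fun_def smooth_on_def
proof (intro ballI allI, clarify)
  fix V p r assume chart: "(V, p) \<in> charts M"
  show "Ck_on r V (\<phi> i \<circ> p)"
  proof (rule Ck_on_locally)
    fix t assume "t \<in> V"
    then have "p t \<in> points M" using riemannian_manifold_chartD(5)[OF manifold chart] by blast
    then obtain W where W: "open W" "inj_on angular W" "\<pi> (p t) \<in> angular ` W"
      using torus_chart_around by blast
    note L = open_dom[OF chart W(1,2)]
    have "Ck_on r (ldom V p W) (lrep V p W)"
      using assms chart W charts_flat_torus unfolding smooth_map_def smooth_on_def by blast
    then have "Ck_on r (ldom V p W) (\<lambda>s. of_real (norm (\<phi> i x0)) * cis (lrep V p W s $ i))"
      by (intro Ck_on_bounded_linear[OF bounded_linear_mult_right L] Ck_on_cis[OF L]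
          Ck_on_bounded_linear[OF bounded_linear_vec_nth L])
    then have "Ck_on r (ldom V p W) (\<phi> i \<circ> p)"
      by (rule Ck_on_cong[OF L]) (simp only: phase_rep[OF chart W(1,2)])
    moreover have "t \<in> ldom V p W" using \<open>t \<in> V\<close> W(3) by (simp add: local_dom_def)
    ultimately show "\<exists>T. open T \<and> t \<in> T \<and> Ck_on r T (\<phi> i \<circ> p)" using L by blast
  qed
qed

end

text \<open>Connectedness is what forces one modulus on all of \<open>M\<close>; on separate
  components the moduli could differ. The zero function satisfies the equations of an eigenfamily
  but has no quotient by its modulus, so each member is required to be nonzero somewhere.\<close>

theorem theorem4p5:
  fixes M :: "('m::{t2_space,second_countable_topology}, 'n::finite) riem"
    and A :: "real^'k::finite^'k"
    and \<phi> :: "'k \<Rightarrow> 'm \<Rightarrow> complex"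
  assumes manifold: "riemannian_manifold M"
    and compact: "compact (points M)"
    and connected: "connected (points M)"
    and symmetric: "transpose A = A"
    and nonzero: "\<And>i. \<exists>x \<in> points M. \<phi> i x \<noteq> 0"
  shows "reduced_eigenfamily M (\<chi> i. - of_real (A $ i $ i)) (\<chi> i j. - of_real (A $ i $ j)) \<phi>
    \<longleftrightarrow>
    positive_definite A \<and>
    (\<forall>x0 \<in> points M.
       (\<forall>i. \<phi> i x0 \<noteq> 0) \<and>
       torus_map \<phi> x0 ` points M \<subseteq> points (flat_torus (matrix_inv A)) \<and>
       riemannian_submersion M (flat_torus (matrix_inv A)) (torus_map \<phi> x0) \<and>
       harmonic_map M (flat_torus (matrix_inv A)) (torus_map \<phi> x0))"
    (is "?eigen \<longleftrightarrow> _ \<and> (\<forall>x0 \<in> points M. ?submersion x0)")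
proof
  assume ?eigen
  then have eig: "eigenfamily M (\<chi> i. - of_real (A $ i $ i)) (\<chi> i j. - of_real (A $ i $ j)) \<phi>"
    and inv: "invertible A"
    by (auto simp: reduced_eigenfamily_def invertible_complex_matrix_iff)
  then have smooth: "smooth_fun M (\<phi> i)" for i by (simp add: eigenfamily_def)
  have setting: "torus_setting M \<phi> x0" if x0: "x0 \<in> points M" for x0
  proof
    fix i
    have const: "norm (\<phi> i x) = norm (\<phi> i x0)" if "x \<in> points M" for x
      using eigenfamily_norm_constant[OF manifold compact connected eig that x0] .
    then show "norm (\<phi> i x) = norm (\<phi> i x0)" if "x \<in> points M" for x using that .
    show "\<phi> i x0 \<noteq> 0" using nonzero[of i] const by force
    show "continuous_on (points M) (\<phi> i)" by (rule smooth_fun_continuous_on[OF manifold smooth])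
  qed (rule manifold)
  have eqs: "(\<forall>i. laplacian (riem_metric M (V, p)) (\<lambda>s. local_rep (torus_map \<phi> x0) (V, p) (W, angular) s $ i) t = 0)
      \<and> (\<forall>i j. grad_prod (matrix_inv (riem_metric M (V, p) t))
            (\<lambda>s. local_rep (torus_map \<phi> x0) (V, p) (W, angular) s $ i)
            (\<lambda>s. local_rep (torus_map \<phi> x0) (V, p) (W, angular) s $ j) t = A $ i $ j)"
    if "x0 \<in> points M" "(V, p) \<in> charts M" "open W" "inj_on angular W"
      "t \<in> local_dom (torus_map \<phi> x0) (V, p) (W, angular)" for x0 V p W t
  proof -
    interpret torus_setting M \<phi> x0 by (rule setting[OF that(1)])
    have "t \<in> V" using that(5) by (simp add: local_dom_def)
    then show ?thesis
      using eig that(2)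
      by (subst eigen_equations_iff[OF that(2-4) Ck_on_rep[OF that(2-4) smooth] that(5), symmetric])
        (auto simp: eigenfamily_def)
  qed
  \<comment> \<open>\<open>A\<close> is constant, so the Gram matrix at a single point
    decides.\<close>
  have pd: "positive_definite A"
  proof -
    obtain x0 where x0: "x0 \<in> points M" using nonzero by blast
    interpret torus_setting M \<phi> x0 by (rule setting[OF x0])
    obtain V p t where c: "(V, p) \<in> charts M" "t \<in> V" "x0 = p t"
      using riemannian_manifold_point[OF manifold x0] .
    obtain W where W: "open W" "inj_on angular W" "\<pi> x0 \<in> angular ` W"
      using torus_chart_around[OF x0] .
    have "t \<in> ldom V p W" using c W by (simp add: local_dom_def)
    then show ?thesis
      using eqs[OF x0 c(1) W(1,2)]
      by (intro gram_positive_definite_inv[OF c(1) W(1,2) Ck_on_rep[OF c(1) W(1,2) smooth] _ _ inv]) auto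
  qed
  have "?submersion x0" if x0: "x0 \<in> points M" for x0
  proof -
    interpret torus_setting M \<phi> x0 by (rule setting[OF x0])
    have sm: "smooth_map M (flat_torus (matrix_inv A)) \<pi>" by (rule smooth_map_torus[OF smooth])
    have "riemannian_submersion M (flat_torus (matrix_inv A)) \<pi>"
      unfolding riemannian_submersion_def
    proof (intro conjI sm ballI)
      fix c d t assume c: "c \<in> charts M" and d: "d \<in> charts (flat_torus (matrix_inv A))" and t: "t \<in> local_dom \<pi> c d"
      obtain V p where Vp: "c = (V, p)" by (cases c)
      obtain W where W: "d = (W, angular)" "open W" "inj_on angular W" using d charts_flat_torus by blast
      note a = c[unfolded Vp] W(2,3) and t = t[unfolded Vp W(1)]
      show "let D = frechet_derivative (local_rep \<pi> c d) (at t);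
          G = riem_metric M c t;
          H = riem_metric (flat_torus (matrix_inv A)) d (local_rep \<pi> c d t);
          horizontal = {u. \<forall>w. D w = 0 \<longrightarrow> u \<bullet> (G *v w) = 0}
        in surj D \<and> (\<forall>u \<in> horizontal. \<forall>v \<in> horizontal. D u \<bullet> (H *v D v) = u \<bullet> (G *v v))"
        unfolding Vp W(1) submersion_iff[OF a Ck_on_rep[OF a smooth] t pd]
        using eqs[OF x0 a t] by blast
    qed
    moreover have "harmonic_map M (flat_torus (matrix_inv A)) \<pi>"
      unfolding harmonic_map_def
    proof (intro conjI sm ballI)
      fix c d t assume c: "c \<in> charts M" and d: "d \<in> charts (flat_torus (matrix_inv A))" and t: "t \<in> local_dom \<pi> c d"
      obtain V p where Vp: "c = (V, p)" by (cases c)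
      obtain W where W: "d = (W, angular)" "open W" "inj_on angular W" using d charts_flat_torus by blast
      note a = c[unfolded Vp] W(2,3) and t = t[unfolded Vp W(1)]
      show "tension (riem_metric M c) (riem_metric (flat_torus (matrix_inv A)) d) (local_rep \<pi> c d) t = 0"
        unfolding Vp W(1) tension_zero_iff[OF a Ck_on_rep[OF a smooth] t]
        using eqs[OF x0 a t] by blast
    qed
    ultimately show ?thesis
      using torus_setting.nonzero[OF setting[OF x0]] torus_map_range by blast
  qed
  then show "positive_definite A \<and> (\<forall>x0 \<in> points M. ?submersion x0)" using pd by blast
next
  assume "positive_definite A \<and> (\<forall>x0 \<in> points M. ?submersion x0)"
  \<comment> \<open>One base point carries all the information for this direction.\<close>
  moreover obtain x0 where x0: "x0 \<in> points M" using nonzero by blast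
  ultimately have pd: "positive_definite A" and nz: "\<And>i. \<phi> i x0 \<noteq> 0"
    and range: "torus_map \<phi> x0 ` points M \<subseteq> points (flat_torus (matrix_inv A))"
    and submersion: "riemannian_submersion M (flat_torus (matrix_inv A)) (torus_map \<phi> x0)"
    and harmonic: "harmonic_map M (flat_torus (matrix_inv A)) (torus_map \<phi> x0)"
    by blast+
  have sm: "smooth_map M (flat_torus (matrix_inv A)) (torus_map \<phi> x0)"
    using harmonic by (simp add: harmonic_map_def)
  interpret torus_setting M \<phi> x0
  proof
    show "norm (\<phi> i x) = norm (\<phi> i x0)" if "x \<in> points M" for i x
    proof -
      \<comment> \<open>Here constancy of the moduli is read off from the torus map taking values in
        the torus.\<close>
      have "norm (torus_map \<phi> x0 x $ i) = 1" using range that by (auto simp: flat_torus_def)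
      then show ?thesis using nz[of i] by (simp add: torus_map_def norm_divide)
    qed
    show "continuous_on (points M) (\<phi> i)" for i
    proof -
      have "continuous_on (points M) (torus_map \<phi> x0)" using sm by (simp add: smooth_map_def)
      then have "continuous_on (points M) (\<lambda>x. of_real (norm (\<phi> i x0)) * torus_map \<phi> x0 x $ i)"
        by (intro continuous_intros)
      then show ?thesis using nz[of i] by (simp add: torus_map_def)
    qed
  qed (use manifold nz in auto)
  note smooth = smooth_fun_of_torus_map[OF sm]
  \<comment> \<open>The eigenfamily equations concern every point of every chart of
    \<open>M\<close>, the submersion conditions only points mapped into a given torus chart; a chart
    around the image point bridges the two.\<close>
  have eqs: "(\<forall>i. tau (riem_metric M (V, p)) (\<phi> i \<circ> p) t = - of_real (A $ i $ i) * (\<phi> i \<circ> p) t) \<and>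
     (\<forall>i j. kappa (riem_metric M (V, p)) (\<phi> i \<circ> p) (\<phi> j \<circ> p) t
        = - of_real (A $ i $ j) * (\<phi> i \<circ> p) t * (\<phi> j \<circ> p) t)"
    if c: "(V, p) \<in> charts M" "t \<in> V" for V p t
  proof -
    have "p t \<in> points M" using riemannian_manifold_chartD(5)[OF manifold c(1)] c(2) by blast
    then obtain W where W: "open W" "inj_on angular W" "\<pi> (p t) \<in> angular ` W"
      using torus_chart_around by blast
    have t: "t \<in> ldom V p W" using c(2) W(3) by (simp add: local_dom_def)
    have d: "(W, angular) \<in> charts (flat_torus (matrix_inv A))" using W charts_flat_torus by blast
    note a = c(1) W(1,2) Ck_on_rep[OF c(1) W(1,2) smooth] t
    have "\<forall>i. laplacian (riem_metric M (V, p)) (\<lambda>s. lrep V p W s $ i) t = 0"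
      by (rule iffD1[OF tension_zero_iff[OF a, of "matrix_inv A"]])
        (use harmonic c(1) d t in \<open>unfold harmonic_map_def, blast\<close>)
    moreover have "\<forall>i j. grad_prod (matrix_inv (riem_metric M (V, p) t))
            (\<lambda>s. lrep V p W s $ i) (\<lambda>s. lrep V p W s $ j) t = A $ i $ j"
      by (rule iffD1[OF submersion_iff[OF a pd]])
        (use submersion c(1) d t in \<open>unfold riemannian_submersion_def, blast\<close>)
    ultimately show ?thesis unfolding eigen_equations_iff[OF a] by blast
  qed
  have "eigenfamily M (\<chi> i. - of_real (A $ i $ i)) (\<chi> i j. - of_real (A $ i $ j)) \<phi>"
    unfolding eigenfamily_def
  proof (intro conjI allI smooth)
    show "transpose (\<chi> i j. - complex_of_real (A $ i $ j)) = (\<chi> i j. - complex_of_real (A $ i $ j))"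
      using symmetric_entry[OF symmetric] by (simp add: transpose_def vec_eq_iff)
  qed (use eqs in auto)
  then show ?eigen
    unfolding reduced_eigenfamily_def invertible_complex_matrix_iff
    using positive_definite_invertible[OF pd] by blast
qed

end
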